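(* Let $P$ be an ideal hexagon in the hyperbolic plane $\mathbb{H}^2$, let $A(P)$ be its alternating perimeter, and let $T_P$ be the (possibly degenerate) geodesic triangle bounded by the three geodesics connecting opposite vertices of $P$. Then the alternating perimeter of $P$ is, up to sign, twice the perimeter of $T_P$; that is, $|A(P)| = 2\cdot \mathrm{perimeter}(T_P)$.
   Context: $\mathbb{H}^2$ is the Poincaré disk model of the hyperbolic plane: its points are those of the open unit disk in $\mathbb{C}$; its geodesics are the intersections with the open unit disk of circles meeting the unit circle at right angles (including diameters as degenerate circles). The ideal boundary $\partial\mathbb{H}^2$ is the unit circle, and its points are called ideal points. Hyperbolic distance: for $b\neq c\in\mathbb{H}^2$, if the geodesic through $b,c$ has ideal endpoints $a,d$ labeled so that $a,b,c,d$ occur in order, then $\mathrm{dist}(b,c)=\log\frac{(a-c)(b-d)}{(a-b)(c-d)}$; and $\mathrm{dist}(b,b)=0$. A horodisk is a closed Euclidean disk of positive radius contained in $\mathbb{H}^2$ except for a single ideal point; it is said to be centered (or placed) at that ideal point. An ideal hexagon $P$ is the closed loop with six distinct ideal vertices $v_1,\dots,v_6$, listed in cyclic order around the unit circle, obtained by joining consecutive vertices by geodesics. The $k$th side is the geodesic joining $v_k$ to $v_{k+1}$ (indices mod $6$). The pairs of opposite vertices are $(v_1,v_4)$, $(v_2,v_5)$, $(v_3,v_6)$. Alternating perimeter: place horodisks $H_1,\dots,H_6$, with $H_k$ centered at $v_k$, such that consecutive ones (cyclically) do not overlap (tangency is allowed). Let $S_k'$ be the finite hyperbolic length of the portion of the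 $k$th side lying outside the two horodisks centered at its endpoints. Then $A(P)=(S_1'+S_3'+S_5')-(S_2'+S_4'+S_6')$. This value does not depend on the choice of horodisks. The triangle $T_P$ has as vertices the pairwise intersection points in $\mathbb{H}^2$ of the three geodesics joining opposite vertices of $P$; its perimeter is the sum of the three pairwise hyperbolic distances between these points (if the three geodesics meet in one point, $T_P$ is that point and the perimeter is $0$). *)

theory Defs
  imports "HOL-Analysis.Analysis"
begin

definition hyperbolic_plane :: "complex set" where
  "hyperbolic_plane = ball 0 1"

definition ideal_boundary :: "complex set" where
  "ideal_boundary = sphere 0 1"

text \<open>Two circles meet at right angles if at every common point (and there is one) the radii
  are perpendicular.\<close>

definition is_geodesic :: "complex set \<Rightarrow> bool" where
  "is_geodesic G \<longleftrightarrow>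
     (\<exists>c r. r > 0 \<and> sphere c r \<inter> sphere 0 1 \<noteq> {} \<and>
            (\<forall>p \<in> sphere c r \<inter> sphere 0 1. (p - c) \<bullet> p = 0) \<and>
            G = sphere c r \<inter> hyperbolic_plane) \<or>
     (\<exists>u. u \<noteq> 0 \<and> G = {complex_of_real t * u | t. True} \<inter> hyperbolic_plane)"

definition ideal_endpoints :: "complex set \<Rightarrow> complex set" where
  "ideal_endpoints G = closure G \<inter> ideal_boundary"

definition geodesic_joining :: "complex \<Rightarrow> complex \<Rightarrow> complex set" where
  "geodesic_joining a d = (THE G. is_geodesic G \<and> ideal_endpoints G = {a, d})"

text \<open>An injective parametrization by \<open>[0,1]\<close> of the geodesic together with its two ideal
  endpoints. It only serves to express the order of points along the geodesic.\<close>

definition parametrizes :: "(real \<Rightarrow> complex) \<Rightarrow> complex set \<Rightarrow> bool" where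
  "parametrizes \<gamma> G \<longleftrightarrow>
     is_geodesic G \<and> arc \<gamma> \<and> path_image \<gamma> = closure G \<and>
     ideal_endpoints G = {pathstart \<gamma>, pathfinish \<gamma>}"

definition in_order :: "complex \<Rightarrow> complex \<Rightarrow> complex \<Rightarrow> complex \<Rightarrow> bool" where
  "in_order a b c d \<longleftrightarrow>
     (\<exists>G \<gamma> s t. parametrizes \<gamma> G \<and> 0 < s \<and> s < t \<and> t < 1 \<and>
        pathstart \<gamma> = a \<and> \<gamma> s = b \<and> \<gamma> t = c \<and> pathfinish \<gamma> = d)"

text \<open>The cross ratio below is real and greater than 1; \<open>Re\<close> only changes the type.\<close>

definition hdist :: "complex \<Rightarrow> complex \<Rightarrow> real" where
  "hdist b c = (if b = c then 0
     else (THE l. \<exists>a d. in_order a b c d \<and>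
             l = ln (Re (((a - c) * (b - d)) / ((a - b) * (c - d))))))"

text \<open>Length of an open geodesic segment, given as a point set: the distance between its
  endpoints. For \<open>s = t\<close> the segment is empty and has length 0.\<close>

definition segment_length :: "complex set \<Rightarrow> real" where
  "segment_length X = (THE l. \<exists>G \<gamma> s t. parametrizes \<gamma> G \<and> 0 < s \<and> s \<le> t \<and> t < 1 \<and>
     X = \<gamma> ` {s<..<t} \<and> l = hdist (\<gamma> s) (\<gamma> t))"

definition horodisk_at :: "complex \<Rightarrow> complex set \<Rightarrow> bool" where
  "horodisk_at p H \<longleftrightarrow>
     p \<in> ideal_boundary \<and> (\<exists>c r. r > 0 \<and> H = cball c r) \<and> H - hyperbolic_plane = {p}"

text \<open>A hexagon is given by its vertices \<open>v 1, \<dots>, v 6\<close>; other values of \<open>v\<close> are irrelevant.\<close>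

definition succ6 :: "nat \<Rightarrow> nat" where
  "succ6 k = (if k = 6 then 1 else k + 1)"

text \<open>The cyclic order may be counterclockwise (\<open>\<epsilon> = 1\<close>) or clockwise (\<open>\<epsilon> = -1\<close>).\<close>

definition ideal_hexagon :: "(nat \<Rightarrow> complex) \<Rightarrow> bool" where
  "ideal_hexagon v \<longleftrightarrow>
     (\<exists>\<epsilon> \<theta>. \<epsilon> \<in> {1, -1} \<and> strict_mono_on {1..6} \<theta> \<and> \<theta> 6 < \<theta> 1 + 2 * pi \<and>
        (\<forall>k \<in> {1..6}. v k = cis (\<epsilon> * \<theta> k)))"

definition side :: "(nat \<Rightarrow> complex) \<Rightarrow> nat \<Rightarrow> complex set" where
  "side v k = geodesic_joining (v k) (v (succ6 k))"

text \<open>Disjoint interiors: consecutive horodisks may be tangent.\<close>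

definition admissible_horodisks :: "(nat \<Rightarrow> complex) \<Rightarrow> (nat \<Rightarrow> complex set) \<Rightarrow> bool" where
  "admissible_horodisks v H \<longleftrightarrow>
     (\<forall>k \<in> {1..6}. horodisk_at (v k) (H k) \<and> interior (H k) \<inter> interior (H (succ6 k)) = {})"

definition truncated_length :: "(nat \<Rightarrow> complex) \<Rightarrow> (nat \<Rightarrow> complex set) \<Rightarrow> nat \<Rightarrow> real" where
  "truncated_length v H k = segment_length (side v k - (H k \<union> H (succ6 k)))"

definition alternating_perimeter :: "(nat \<Rightarrow> complex) \<Rightarrow> real" where
  "alternating_perimeter v = (THE A. \<exists>H. admissible_horodisks v H \<and>
     A = (truncated_length v H 1 + truncated_length v H 3 + truncated_length v H 5)
       - (truncated_length v H 2 + truncated_length v H 4 + truncated_length v H 6))"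

definition diagonal :: "(nat \<Rightarrow> complex) \<Rightarrow> nat \<Rightarrow> complex set" where
  "diagonal v k = geodesic_joining (v k) (v (k + 3))"

definition triangle_vertex :: "(nat \<Rightarrow> complex) \<Rightarrow> nat \<Rightarrow> nat \<Rightarrow> complex" where
  "triangle_vertex v j k = (THE z. z \<in> diagonal v j \<inter> diagonal v k)"

definition triangle_perimeter :: "(nat \<Rightarrow> complex) \<Rightarrow> real" where
  "triangle_perimeter v =
     hdist (triangle_vertex v 1 2) (triangle_vertex v 2 3) +
     hdist (triangle_vertex v 2 3) (triangle_vertex v 1 3) +
     hdist (triangle_vertex v 1 3) (triangle_vertex v 1 2)"

end

theory Submission
  imports Defs
begin

text \<open>
  Write \<open>[jk]\<close> for the chord length \<open>norm (v j - v k)\<close>. Both perimeters are computed in terms of these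
  numbers, and then compared.

  Given ideal points \<open>a\<close> and \<open>d\<close>, a Moebius map takes the disk to the right half-plane and the geodesic
  from \<open>a\<close> to \<open>d\<close> to the positive real axis. Its value is called the half-plane coordinate here. On
  the geodesic, distance is the difference of logarithms of this coordinate (lemma \<open>hdist_eq_ln_coord_diff\<close>).

  A horodisk of radius \<open>r\<close> at \<open>a\<close> or \<open>d\<close> cuts the geodesic at an explicit coordinate, and the truncated
  length is \<open>2 * ln (norm (a - d))\<close> plus a term for each of the two horodisks (lemma
  \<open>truncated_geodesic_length\<close>). In the alternating sum the horodisk terms cancel, so that \<open>A(P)\<close> is twice
  the logarithm of \<open>[12][34][56] / ([23][45][61])\<close> (lemma \<open>alternating_perimeter_eq\<close>).

  A geodesic with ideal endpoints \<open>p\<close> and \<open>q\<close> on either side of the one from \<open>a\<close> to \<open>d\<close> becomes a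
  semicircle orthogonal to the imaginary axis, which crosses the positive real axis at the geometric
  mean of the distances of its endpoints from \<open>0\<close> (lemma \<open>mem_crossing_geodesic_iff\<close>). So each side of the
  triangle is half the absolute value of the logarithm of a quotient of chord lengths (lemma
  \<open>hdist_crossings\<close>).

  Multiplying the three quotients, suitably inverted, gives the square of
  \<open>[12][34][56] / ([23][45][61])\<close>, since all diagonals cancel. It remains to see that the three
  logarithms have the same sign, so that the absolute values add up. For each quotient, numerator minus
  denominator is a main diagonal \<open>[14]\<close>, \<open>[25]\<close> or \<open>[36]\<close> times the same number
  \<open>[12][34][56] - [23][45][61]\<close> (lemma \<open>hexagon_bracket_identity\<close>).
\<close>

section \<open>The half-plane coordinate of an ideal geodesic\<close>

definition ideal_pair :: "complex \<Rightarrow> complex \<Rightarrow> bool" where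
  "ideal_pair a d \<longleftrightarrow> norm a = 1 \<and> norm d = 1 \<and> a \<noteq> d"

text \<open>The Moebius map taking the unit disk to the right half-plane, \<open>a\<close> to \<open>0\<close> and \<open>d\<close> to \<open>\<infinity>\<close>. The
  factor \<open>1 - d * cnj a\<close> rotates the image so that the unit circle becomes the imaginary axis,
  hence the geodesic from \<open>a\<close> to \<open>d\<close> becomes the positive real axis.\<close>
definition hcoord :: "complex \<Rightarrow> complex \<Rightarrow> complex \<Rightarrow> complex" where
  "hcoord a d z = (1 - d * cnj a) * (z - a) / (d - z)"

definition geodesic_arc :: "complex \<Rightarrow> complex \<Rightarrow> complex set" where
  "geodesic_arc a d = {z. norm z < 1 \<and> Im (hcoord a d z) = 0}"

lemma norm_eq_1_iff_parts: "norm (a::complex) = 1 \<longleftrightarrow> (Re a)\<^sup>2 + (Im a)\<^sup>2 = 1"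
  by (simp add: norm_complex_def)

lemma mult_cnj_eq_1: "norm (a::complex) = 1 \<Longrightarrow> a * cnj a = 1"
  by (metis complex_norm_square of_real_1 one_power2)

lemma ideal_pair_sym: "ideal_pair a d \<Longrightarrow> ideal_pair d a"
  by (auto simp: ideal_pair_def)

lemma unit_inner_lt_one:
  assumes "ideal_pair a d" shows "Re (d * cnj a) < 1"
proof -
  have "0 < (norm (d - a))\<^sup>2" using assms by (auto simp: ideal_pair_def)
  thus ?thesis using assms unfolding cmod_power2 ideal_pair_def norm_eq_1_iff_parts
    by (simp add: power2_eq_square algebra_simps)
qed

lemma norm_coord_factor: "ideal_pair a d \<Longrightarrow> norm (1 - d * cnj a) = norm (a - d)"
proof -
  assume "ideal_pair a d"
  hence "1 - d * cnj a = (a - d) * cnj a" "norm a = 1"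
    by (auto simp: ideal_pair_def algebra_simps mult_cnj_eq_1)
  thus ?thesis by (simp add: norm_mult)
qed

lemma Re_coord_factor: "ideal_pair a d \<Longrightarrow> Re (1 - d * cnj a) = (norm (a - d))\<^sup>2 / 2"
  unfolding cmod_power2 ideal_pair_def norm_eq_1_iff_parts
    by (simp add: power2_eq_square field_simps)

text \<open>The numerator of \<open>hcoord a d z\<close>, made a polynomial by rationalizing the denominator and
  sorted so that real and imaginary parts can be read off: the first two differences are
  imaginary.\<close>
lemma hcoord_expand:
  assumes "ideal_pair a d" "z \<noteq> d"
  shows "hcoord a d z * of_real ((norm (d - z))\<^sup>2)
     = z * cnj d - cnj (z * cnj d) + (cnj (z * cnj a) - z * cnj a)
       + (1 - z * cnj z) - a * cnj d + d * cnj a * (z * cnj z)"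
proof -
  have d: "a * cnj a = 1" "d * cnj d = 1" using assms by (auto simp: ideal_pair_def mult_cnj_eq_1)
  have "hcoord a d z * of_real ((norm (d - z))\<^sup>2) = (1 - d * cnj a) * (z - a) * cnj (d - z)"
    using assms(2) by (subst complex_norm_square) (simp add: hcoord_def field_simps)
  also have "\<dots> = z * cnj d - z * cnj z - a * cnj d + a * cnj z - (d * cnj d) * cnj a * z
       + d * cnj a * z * cnj z + d * cnj d * (a * cnj a) - d * (a * cnj a) * cnj z"
    by (simp add: algebra_simps)
  finally show ?thesis by (simp add: d algebra_simps)
qed

text \<open>The coordinate lies in the open right half-plane exactly for points of the open disk, and on
  the imaginary axis for boundary points.\<close>
lemma Re_hcoord:
  assumes "ideal_pair a d" "z \<noteq> d"
  shows "2 * Re (hcoord a d z) * (norm (d - z))\<^sup>2 = (1 - (norm z)\<^sup>2) * (norm (a - d))\<^sup>2"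
proof -
  have "Re (hcoord a d z) * (norm (d - z))\<^sup>2 = Re (hcoord a d z * of_real ((norm (d - z))\<^sup>2))"
    by simp
  also have "\<dots> = (1 - (norm z)\<^sup>2) * (1 - Re (d * cnj a))"
    unfolding hcoord_expand[OF assms] unfolding cmod_power2
      by (simp add: power2_eq_square algebra_simps)
  also have "1 - Re (d * cnj a) = (norm (a - d))\<^sup>2 / 2" using Re_coord_factor[OF assms(1)] by simp
  finally show ?thesis by simp
qed

lemma Im_hcoord:
  assumes "ideal_pair a d" "z \<noteq> d"
  shows "Im (hcoord a d z) * (norm (d - z))\<^sup>2
     = Im (d * cnj a) * (1 + (norm z)\<^sup>2) - 2 * Im (z * cnj (a - d))"
proof -
  have "Im (hcoord a d z) * (norm (d - z))\<^sup>2 = Im (hcoord a d z * of_real ((norm (d - z))\<^sup>2))"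
    by simp
  also have "\<dots> = Im (d * cnj a) * (1 + (norm z)\<^sup>2) - 2 * Im (z * cnj (a - d))"
    unfolding hcoord_expand[OF assms] unfolding cmod_power2
      by (simp add: power2_eq_square algebra_simps)
  finally show ?thesis .
qed

text \<open>The Euclidean equation of the geodesic. It treats circles and diameters alike: the
  coefficient of \<open>1 + (norm z)\<^sup>2\<close> vanishes precisely for a diameter.\<close>
lemma geodesic_arc_iff:
  assumes "ideal_pair a d"
  shows "z \<in> geodesic_arc a d \<longleftrightarrow> norm z < 1 \<and>
           Im (d * cnj a) * (1 + (norm z)\<^sup>2) = 2 * Im (z * cnj (a - d))"
proof (cases "norm z < 1")
  case True
  hence "z \<noteq> d" using assms by (auto simp: ideal_pair_def)
  thus ?thesis using Im_hcoord[OF assms \<open>z \<noteq> d\<close>] True by (auto simp: geodesic_arc_def)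
qed (auto simp: geodesic_arc_def)

lemma geodesic_arc_sym:
  assumes "ideal_pair a d" shows "geodesic_arc d a = geodesic_arc a d"
  using assms by (auto simp: geodesic_arc_iff ideal_pair_sym set_eq_iff algebra_simps)

lemma geodesic_arc_coord:
  assumes "ideal_pair a d" "z \<in> geodesic_arc a d"
  shows "norm z < 1" "z \<noteq> a" "z \<noteq> d" "Re (hcoord a d z) > 0"
    "hcoord a d z = of_real (Re (hcoord a d z))"
proof -
  show n: "norm z < 1" using assms by (simp add: geodesic_arc_def)
  thus za: "z \<noteq> a" and zd: "z \<noteq> d" using assms by (auto simp: ideal_pair_def)
  have "(norm z)\<^sup>2 < 1" using n by (simp add: power_less_one_iff)
  hence "0 < (1 - (norm z)\<^sup>2) * (norm (a - d))\<^sup>2" using assms by (simp add: ideal_pair_def)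
  hence "0 < 2 * Re (hcoord a d z) * (norm (d - z))\<^sup>2" using Re_hcoord[OF assms(1) zd] by simp
  thus "Re (hcoord a d z) > 0" using zd by (simp add: zero_less_mult_iff)
  show "hcoord a d z = of_real (Re (hcoord a d z))"
    using assms by (simp add: geodesic_arc_def complex_eq_iff)
qed

lemma hcoord_diff:
  assumes "x \<noteq> d" "y \<noteq> d"
  shows "hcoord a d x - hcoord a d y = (1 - d * cnj a) * (d - a) * (x - y) / ((d - x) * (d - y))"
  using assms by (simp add: hcoord_def divide_simps) (simp add: algebra_simps)

lemma coord_factor_nonzero: "ideal_pair a d \<Longrightarrow> 1 - d * cnj a \<noteq> 0"
  using norm_coord_factor[of a d] by (auto simp: ideal_pair_def)

lemma hcoord_inj:
  assumes "ideal_pair a d" "x \<noteq> d" "y \<noteq> d" "hcoord a d x = hcoord a d y"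
  shows "x = y"
  using hcoord_diff[OF assms(2,3), of a] assms coord_factor_nonzero[OF assms(1)]
    by (auto simp: ideal_pair_def)

text \<open>Reversing the direction of the geodesic inverts the coordinate up to a positive constant, so
  it reverses the order of points.\<close>
lemma hcoord_swap:
  assumes "ideal_pair a d" "z \<noteq> a" "z \<noteq> d"
  shows "hcoord d a z = of_real ((norm (a - d))\<^sup>2) / hcoord a d z"
proof -
  have d: "a * cnj a = 1" "d * cnj d = 1" using assms by (auto simp: ideal_pair_def mult_cnj_eq_1)
  have "hcoord d a z * hcoord a d z = (1 - a * cnj d) * (1 - d * cnj a)"
    using assms(2,3) by (simp add: hcoord_def divide_simps) (simp add: algebra_simps)
  also have "\<dots> = of_real ((norm (a - d))\<^sup>2)"
  proof -
    have "(1 - a * cnj d) * (1 - d * cnj a) = 1 - a * cnj d - d * cnj a + (a * cnj a) * (d * cnj d)"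
      by (simp add: algebra_simps)
    also have "\<dots> = a * cnj a + d * cnj d - a * cnj d - d * cnj a" by (simp add: d)
    finally show ?thesis by (subst complex_norm_square) (simp add: algebra_simps)
  qed
  finally have e: "hcoord d a z * hcoord a d z = of_real ((norm (a - d))\<^sup>2)" .
  have "hcoord a d z \<noteq> 0" using assms coord_factor_nonzero[OF assms(1)] by (simp add: hcoord_def)
  thus ?thesis using e by (simp add: field_simps)
qed

section \<open>An explicit path along the geodesic\<close>

text \<open>The inverse of the half-plane coordinate at the real point \<open>s / (1 - s)\<close>, with denominators
  cleared so that it also makes sense at the ideal endpoint \<open>s = 1\<close>.\<close>
definition geodesic_path :: "complex \<Rightarrow> complex \<Rightarrow> real \<Rightarrow> complex" where
  "geodesic_path a d s = (of_real s * d + of_real (1 - s) * ((1 - d * cnj a) * a)) /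
                    (of_real s + of_real (1 - s) * (1 - d * cnj a))"

lemma geodesic_path_denominator:
  assumes "ideal_pair a d" "0 \<le> s" "s \<le> 1"
  shows "of_real s + of_real (1 - s) * (1 - d * cnj a) \<noteq> 0"
proof -
  have "0 < s + (1 - s) * (1 - Re (d * cnj a))"
  proof (cases "s = 1")
    case False
    thus ?thesis using assms unit_inner_lt_one[OF assms(1)]
      by (intro add_nonneg_pos mult_pos_pos) auto
  qed simp
  moreover have "Re (of_real s + of_real (1 - s) * (1 - d * cnj a)) = s + (1 - s) * (1 - Re (d * cnj a))"
    by simp
  ultimately show ?thesis by (metis less_irrefl zero_complex.simps(1))
qed

lemma geodesic_path_minus:
  assumes "ideal_pair a d" "0 \<le> s" "s \<le> 1"
  defines "q \<equiv> of_real s + of_real (1 - s) * (1 - d * cnj a)"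
  shows "geodesic_path a d s - a = of_real s * (d - a) / q"
    and "d - geodesic_path a d s = of_real (1 - s) * (1 - d * cnj a) * (d - a) / q"
  using geodesic_path_denominator[OF assms(1-3)] unfolding q_def geodesic_path_def
  by (simp_all add: divide_simps) (simp_all add: algebra_simps)

lemma hcoord_path:
  assumes "ideal_pair a d" "0 \<le> s" "s < 1"
  shows "hcoord a d (geodesic_path a d s) = of_real (s / (1 - s))" "geodesic_path a d s \<noteq> d"
proof -
  have s: "s \<le> 1" using assms by simp
  note m = geodesic_path_minus[OF assms(1,2) s] and q = geodesic_path_denominator[OF assms(1,2) s]
  have 1: "1 - complex_of_real s \<noteq> 0" using assms(3) by simp
  have "d - geodesic_path a d s \<noteq> 0"
    unfolding m using q coord_factor_nonzero[OF assms(1)] assms 1 by (auto simp: ideal_pair_def)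
  thus "geodesic_path a d s \<noteq> d" by auto
  show "hcoord a d (geodesic_path a d s) = of_real (s / (1 - s))"
    unfolding hcoord_def m using q coord_factor_nonzero[OF assms(1)] assms 1
      by (auto simp: ideal_pair_def)
qed

lemma geodesic_path_in_geodesic:
  assumes "ideal_pair a d" "0 < s" "s < 1"
  shows "geodesic_path a d s \<in> geodesic_arc a d"
proof -
  let ?z = "geodesic_path a d s"
  have h: "hcoord a d ?z = of_real (s / (1 - s))" "?z \<noteq> d" using hcoord_path[of a d s] assms by auto
  have "0 < 2 * Re (hcoord a d ?z) * (norm (d - ?z))\<^sup>2" using h assms by simp
  also have "\<dots> = (1 - (norm ?z)\<^sup>2) * (norm (a - d))\<^sup>2" using Re_hcoord[OF assms(1) h(2)] .
  finally have "(norm ?z)\<^sup>2 < 1" by (simp add: zero_less_mult_iff)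
  hence "norm ?z < 1" by (simp add: power_less_one_iff)
  thus ?thesis using h by (simp add: geodesic_arc_def)
qed

lemma geodesic_path_surj:
  assumes "ideal_pair a d" "z \<in> geodesic_arc a d"
  shows "z = geodesic_path a d (Re (hcoord a d z) / (1 + Re (hcoord a d z)))"
proof -
  let ?t = "Re (hcoord a d z)" let ?s = "?t / (1 + ?t)"
  note c = geodesic_arc_coord[OF assms]
  have s: "0 \<le> ?s" "?s < 1" using c by auto
  have "?s / (1 - ?s) = ?t" using c(4) by (simp add: field_simps)
  hence "hcoord a d (geodesic_path a d ?s) = hcoord a d z" using hcoord_path(1)[OF assms(1) s] c(5)
    by simp
  thus ?thesis using hcoord_inj[OF assms(1)] hcoord_path(2)[OF assms(1) s] c(3) by metis
qed

lemma geodesic_arc_eq_path_image: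
  assumes "ideal_pair a d" shows "geodesic_arc a d = geodesic_path a d ` {0<..<1}"
proof (intro equalityI subsetI)
  fix z assume "z \<in> geodesic_arc a d"
  thus "z \<in> geodesic_path a d ` {0<..<1}"
    using geodesic_path_surj[OF assms, of z] geodesic_arc_coord(4)[OF assms, of z]
    by (intro image_eqI[of _ _ "Re (hcoord a d z) / (1 + Re (hcoord a d z))"]) auto
qed (use geodesic_path_in_geodesic[OF assms] in auto)

lemma coord_attained:
  assumes "ideal_pair a d" "t > 0"
  shows "\<exists>z \<in> geodesic_arc a d. hcoord a d z = of_real t"
proof -
  have "t / (1 + t) / (1 - t / (1 + t)) = t" using assms by (simp add: field_simps)
  thus ?thesis using geodesic_path_in_geodesic[OF assms(1), of "t / (1 + t)"]
      hcoord_path(1)[OF assms(1), of "t / (1 + t)"] assms(2) by (intro bexI) auto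
qed

text \<open>The rescaling \<open>t / (1 + t)\<close> of the coordinate \<open>t\<close>; unlike \<open>t\<close> itself it is continuous up to
  the endpoint \<open>d\<close>, where \<open>t\<close> is infinite.\<close>
definition path_parameter :: "complex \<Rightarrow> complex \<Rightarrow> complex \<Rightarrow> real" where
  "path_parameter a d z = Re ((1 - d * cnj a) * (z - a) / ((d - z) + (1 - d * cnj a) * (z - a)))"

lemma path_parameter_denominator:
  assumes "ideal_pair a d" "0 \<le> s" "s \<le> 1"
  shows "(d - geodesic_path a d s) + (1 - d * cnj a) * (geodesic_path a d s - a)
     = (1 - d * cnj a) * (d - a) / (of_real s + of_real (1 - s) * (1 - d * cnj a))"
  unfolding geodesic_path_minus[OF assms] using geodesic_path_denominator[OF assms]
  by (simp add: divide_simps) (simp add: algebra_simps)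

lemma path_parameter_path:
  assumes "ideal_pair a d" "0 \<le> s" "s \<le> 1"
  shows "path_parameter a d (geodesic_path a d s) = s"
  unfolding path_parameter_def path_parameter_denominator[OF assms]
    unfolding geodesic_path_minus[OF assms]
  using geodesic_path_denominator[OF assms] coord_factor_nonzero[OF assms(1)] assms
    by (auto simp: ideal_pair_def)

lemma geodesic_path_continuous:
  assumes "ideal_pair a d" shows "continuous_on {0..1} (geodesic_path a d)"
  unfolding geodesic_path_def using geodesic_path_denominator[OF assms]
    by (auto intro!: continuous_intros)

lemma path_parameter_continuous:
  assumes "ideal_pair a d" shows "continuous_on (geodesic_path a d ` {0..1}) (path_parameter a d)"
proof -
  have "(d - z) + (1 - d * cnj a) * (z - a) \<noteq> 0" if "z \<in> geodesic_path a d ` {0..1}" for z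
    using that path_parameter_denominator[OF assms] geodesic_path_denominator[OF assms]
      coord_factor_nonzero[OF assms] assms
    by (auto simp: ideal_pair_def)
  thus ?thesis unfolding path_parameter_def by (auto intro!: continuous_intros)
qed

lemma geodesic_path_ends:
  assumes "ideal_pair a d" shows "geodesic_path a d 0 = a" "geodesic_path a d 1 = d"
  using coord_factor_nonzero[OF assms] by (auto simp: geodesic_path_def)

lemma closure_open_path:
  fixes g :: "real \<Rightarrow> complex"
  assumes "continuous_on {s..t} g" "s < t"
  shows "closure (g ` {s<..<t}) = g ` {s..t}"
proof
  have "compact (g ` {s..t})" by (intro compact_continuous_image assms) auto
  thus "closure (g ` {s<..<t}) \<subseteq> g ` {s..t}"
    by (intro closure_minimal compact_imp_closed) auto
  have c: "closure {s<..<t} = {s..t}" using assms by (simp add: closure_greaterThanLessThan)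
  show "g ` {s..t} \<subseteq> closure (g ` {s<..<t})"
    using image_closure_subset[of "{s<..<t}" g "closure (g ` {s<..<t})"] assms c
    by (simp add: closure_subset)
qed

lemma closure_geodesic_arc:
  assumes "ideal_pair a d" shows "closure (geodesic_arc a d) = geodesic_path a d ` {0..1}"
  unfolding geodesic_arc_eq_path_image[OF assms]
  by (intro closure_open_path geodesic_path_continuous assms) simp

lemma ideal_endpoints_geodesic_arc:
  assumes "ideal_pair a d" shows "ideal_endpoints (geodesic_arc a d) = {a, d}"
proof -
  have "{0..1} = {0<..<1} \<union> {0, 1::real}" by auto
  hence "closure (geodesic_arc a d) = geodesic_arc a d \<union> {a, d}"
    unfolding closure_geodesic_arc[OF assms] using geodesic_path_ends[of a d] assms
    by (simp add: image_Un geodesic_arc_eq_path_image[OF assms])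
  moreover have "geodesic_arc a d \<inter> sphere 0 1 = {}" by (auto simp: geodesic_arc_def)
  ultimately show ?thesis using assms
    by (auto simp: ideal_endpoints_def ideal_boundary_def ideal_pair_def)
qed

section \<open>Geodesics are the arcs between two ideal points\<close>

lemma norm_minus_sq: "(norm (z - c))\<^sup>2 = (norm z)\<^sup>2 - 2 * Re (z * cnj c) + (norm c)\<^sup>2"
  for z c :: complex
  unfolding cmod_power2 by (simp add: power2_eq_square algebra_simps)

text \<open>The circle with centre \<open>c\<close> and radius \<open>r\<close> meets the unit circle at right angles iff \<open>(norm
  c)\<^sup>2 = 1 + r\<^sup>2\<close>; its common points with the unit circle are then the contact points of the
  tangents from \<open>c\<close>, which are the points \<open>a\<close> and \<open>d\<close> below.\<close>
lemma orthogonal_circle_is_geodesic_arc: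
  assumes r: "r > 0" and c: "(norm c)\<^sup>2 = 1 + r\<^sup>2"
  defines "a \<equiv> (1 + \<i> * of_real r) / cnj c" and "d \<equiv> (1 - \<i> * of_real r) / cnj c"
  shows "ideal_pair a d" "sphere c r \<inter> hyperbolic_plane = geodesic_arc a d"
proof -
  have c0: "c \<noteq> 0" using c by (auto simp: sum_power2_eq_zero_iff add_nonneg_eq_0_iff)
  have nc: "norm c = sqrt (1 + r\<^sup>2)" using c by (metis norm_ge_zero real_sqrt_unique)
  have "norm (1 + \<i> * of_real r) = sqrt (1 + r\<^sup>2)" "norm (1 - \<i> * of_real r) = sqrt (1 + r\<^sup>2)"
    by (simp_all add: norm_complex_def)
  moreover have "sqrt (1 + r\<^sup>2) \<noteq> 0" by (simp add: add_nonneg_eq_0_iff)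
  moreover have "1 + \<i> * of_real r \<noteq> 1 - \<i> * of_real r" using r by (simp add: complex_eq_iff)
  ultimately show ip: "ideal_pair a d"
    using c0 by (simp add: ideal_pair_def a_def d_def norm_divide nc)
  have q: "c * cnj c = of_real (1 + r\<^sup>2)" using c by (metis complex_norm_square)
  have "z \<in> sphere c r \<inter> hyperbolic_plane \<longleftrightarrow> z \<in> geodesic_arc a d" for z
  proof -
    have e1: "d * cnj a = (1 - \<i> * of_real r)\<^sup>2 / of_real (1 + r\<^sup>2)"
      unfolding a_def d_def q[symmetric] using c0 by (simp add: power2_eq_square field_simps)
    have e2: "z * cnj (a - d) = of_real (- 2 * r) * (\<i> * (z * cnj c)) / of_real (1 + r\<^sup>2)"
      unfolding a_def d_def q[symmetric] using c0 by (simp add: field_simps)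
    have p: "1 + r\<^sup>2 > 0" by (simp add: add_pos_nonneg)
    have i1: "Im (d * cnj a) = - 2 * r / (1 + r\<^sup>2)"
      unfolding e1 Im_divide_of_real by (simp add: power2_eq_square)
    have i2: "Im (z * cnj (a - d)) = - 2 * r * Re (z * cnj c) / (1 + r\<^sup>2)"
      unfolding e2 Im_divide_of_real by simp
    have "norm (z - c) = r \<longleftrightarrow> (norm (z - c))\<^sup>2 = r\<^sup>2" using r by (simp add: power2_eq_iff_nonneg)
    also have "\<dots> \<longleftrightarrow> 1 + (norm z)\<^sup>2 = 2 * Re (z * cnj c)"
      unfolding norm_minus_sq c by linarith
    also have "\<dots> \<longleftrightarrow> (- 2 * r / (1 + r\<^sup>2)) * (1 + (norm z)\<^sup>2) = (- 2 * r / (1 + r\<^sup>2)) * (2 * Re (z * cnj c))"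
      using r p by (subst mult_cancel_left) auto
    also have "\<dots> \<longleftrightarrow> Im (d * cnj a) * (1 + (norm z)\<^sup>2) = 2 * Im (z * cnj (a - d))"
      unfolding i1 i2 by (simp only: mult_ac times_divide_eq_right times_divide_eq_left)
    finally show ?thesis using geodesic_arc_iff[OF ip, of z]
      by (auto simp: hyperbolic_plane_def dist_norm norm_minus_commute)
  qed
  thus "sphere c r \<inter> hyperbolic_plane = geodesic_arc a d" by blast
qed

lemma diameter_is_geodesic_arc:
  assumes "norm a = 1"
  shows "{complex_of_real t * a | t. True} \<inter> hyperbolic_plane = geodesic_arc a (- a)"
proof -
  have ip: "ideal_pair a (- a)" using assms
    by (auto simp: ideal_pair_def complex_eq_iff norm_complex_def)
  have a: "a * cnj a = 1" using assms by (rule mult_cnj_eq_1)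
  have "(\<exists>t. z = complex_of_real t * a) \<longleftrightarrow> Im (z * cnj a) = 0" for z
  proof
    assume "\<exists>t. z = complex_of_real t * a"
    then obtain t where "z * cnj a = of_real t * (a * cnj a)" by auto
    thus "Im (z * cnj a) = 0" by (simp add: a)
  next
    assume i: "Im (z * cnj a) = 0"
    have "z = z * cnj a * a" using a by (simp add: algebra_simps)
    also have "z * cnj a = of_real (Re (z * cnj a))" using i by (simp add: complex_eq_iff)
    finally show "\<exists>t. z = complex_of_real t * a" by blast
  qed
  moreover have "Im (- a * cnj a) = 0" by simp
  moreover have "Im (z * cnj (a - - a)) = 2 * Im (z * cnj a)" for z by simp
  ultimately have "z \<in> {complex_of_real t * a | t. True} \<inter> hyperbolic_plane \<longleftrightarrow> z \<in> geodesic_arc a (- a)" for z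
    unfolding geodesic_arc_iff[OF ip] by (auto simp: hyperbolic_plane_def)
  thus ?thesis by blast
qed

lemma is_geodesic_imp_between:
  assumes "is_geodesic G" shows "\<exists>a d. ideal_pair a d \<and> G = geodesic_arc a d"
  using assms unfolding is_geodesic_def
proof (elim disjE exE conjE)
  fix c r assume r: "r > 0" and ne: "sphere c r \<inter> sphere 0 1 \<noteq> {}"
    and perp: "\<forall>p \<in> sphere c r \<inter> sphere 0 1. (p - c) \<bullet> p = 0"
    and G: "G = sphere c r \<inter> hyperbolic_plane"
  obtain p where pm: "p \<in> sphere c r \<inter> sphere 0 1" using ne by blast
  hence p: "norm (p - c) = r" "norm p = 1" by (auto simp: dist_norm norm_minus_commute)
  have "(p - c) \<bullet> p = 0" using perp pm by blast
  hence "Re (p * cnj c) = (norm p)\<^sup>2"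
    unfolding inner_complex_def cmod_power2 by (simp add: power2_eq_square algebra_simps)
  hence "(norm c)\<^sup>2 = 1 + r\<^sup>2" using norm_minus_sq[of p c] p by simp
  from orthogonal_circle_is_geodesic_arc[OF r this] G show ?thesis by blast
next
  fix u :: complex assume u: "u \<noteq> 0"
    and G: "G = {complex_of_real t * u | t. True} \<inter> hyperbolic_plane"
  let ?a = "u / of_real (norm u)"
  have "norm ?a = 1" using u by (simp add: norm_divide)
  moreover have "{complex_of_real t * u | t. True} = {complex_of_real t * ?a | t. True}"
  proof (intro equalityI subsetI; clarsimp)
    fix t show "\<exists>t'. complex_of_real t * u = complex_of_real t' * u / of_real (norm u)"
      using u by (intro exI[of _ "t * norm u"]) simp
    show "\<exists>t'. complex_of_real t * u / of_real (norm u) = complex_of_real t' * u"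
      by (intro exI[of _ "t / norm u"]) simp
  qed
  moreover have "ideal_pair ?a (- ?a)" using u by (auto simp: ideal_pair_def norm_divide)
  ultimately show ?thesis using diameter_is_geodesic_arc[of ?a] G by blast
qed

text \<open>If the endpoints are not antipodal, the centre of the orthogonal circle is the intersection
  of the tangents at \<open>a\<close> and \<open>d\<close>, i.e. \<open>(a + d) / (1 + Re (d * cnj a))\<close>.\<close>
lemma is_geodesic_geodesic_arc:
  assumes "ideal_pair a d" shows "is_geodesic (geodesic_arc a d)"
proof (cases "d = - a")
  case True
  thus ?thesis using diameter_is_geodesic_arc[of a] assms unfolding is_geodesic_def
    by (intro disjI2 exI[of _ a]) (auto simp: ideal_pair_def)
next
  case False
  have n: "(Re a)\<^sup>2 + (Im a)\<^sup>2 = 1" "(Re d)\<^sup>2 + (Im d)\<^sup>2 = 1" using assms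
    by (auto simp: ideal_pair_def norm_eq_1_iff_parts)
  have na: "norm a = 1" "norm d = 1" using assms by (auto simp: ideal_pair_def)
  define S where "S = 1 + Re (d * cnj a)"
  have nad: "(norm (a + d))\<^sup>2 = 2 * S"
    using n unfolding cmod_power2 S_def by (simp add: power2_eq_square algebra_simps)
  moreover have "a + d \<noteq> 0" using False by (metis add.commute eq_neg_iff_add_eq_0)
  ultimately have S: "S > 0"
    by (metis zero_less_mult_pos zero_less_norm_iff zero_less_numeral zero_less_power)
  have S2: "S < 2" using unit_inner_lt_one[OF assms] by (simp add: S_def)
  define c where "c = (a + d) / of_real S"
  have nc: "(norm c)\<^sup>2 = 2 / S"
    using S nad by (simp add: c_def norm_divide power_divide) (simp add: power2_eq_square)
  define r where "r = sqrt (2 / S - 1)"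
  have r: "r > 0" using S S2 by (simp add: r_def)
  have r2: "r\<^sup>2 = 2 / S - 1" using S S2 by (simp add: r_def)
  have on: "norm (z - c) = r \<longleftrightarrow> 1 + (norm z)\<^sup>2 = 2 * Re (z * cnj c)" for z
  proof -
    have "norm (z - c) = r \<longleftrightarrow> (norm (z - c))\<^sup>2 = r\<^sup>2" using r by (simp add: power2_eq_iff_nonneg)
    also have "\<dots> \<longleftrightarrow> 1 + (norm z)\<^sup>2 = 2 * Re (z * cnj c)"
      unfolding norm_minus_sq nc r2 by linarith
    finally show ?thesis .
  qed
  have rc: "Re (z * cnj c) = Re (z * cnj (a + d)) / S" for z
    by (simp add: c_def add_divide_distrib diff_divide_distrib minus_divide_left algebra_simps)
  have ac: "Re (a * cnj c) = 1"
    unfolding rc using n S by (simp add: S_def power2_eq_square algebra_simps)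
  have I0: "Im (d * cnj a) \<noteq> 0"
  proof
    assume "Im (d * cnj a) = 0"
    moreover have "(norm (d * cnj a))\<^sup>2 = 1" using na by (simp add: norm_mult)
    ultimately have "(Re (d * cnj a))\<^sup>2 = 1" by (simp only: cmod_power2) simp
    hence "Re (d * cnj a) = 1 \<or> Re (d * cnj a) = -1" by (simp add: power2_eq_1_iff)
    thus False using S S2 by (auto simp: S_def)
  qed
  \<comment> \<open>Since \<open>norm a = norm d\<close>, the vectors \<open>a - d\<close> and \<open>a + d\<close> are orthogonal.\<close>
  have key: "S * Im (z * cnj (a - d)) = Im (d * cnj a) * Re (z * cnj (a + d))" for z
  proof -
    have n': "Re a * Re a + Im a * Im a = 1" "Re d * Re d + Im d * Im d = 1"
      using n by (auto simp: power2_eq_square)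
    show ?thesis unfolding S_def using n' by simp algebra
  qed
  have "z \<in> sphere c r \<inter> hyperbolic_plane \<longleftrightarrow> z \<in> geodesic_arc a d" for z
  proof -
    have "1 + (norm z)\<^sup>2 = 2 * Re (z * cnj c) \<longleftrightarrow>
       (S * Im (d * cnj a)) * (1 + (norm z)\<^sup>2) = (S * Im (d * cnj a)) * (2 * Re (z * cnj c))"
      using S I0 by (subst mult_cancel_left) auto
    also have "(S * Im (d * cnj a)) * (2 * Re (z * cnj c)) = S * (2 * Im (z * cnj (a - d)))"
      unfolding mult.left_commute[of S 2] key rc using S
        by (simp only: mult_ac times_divide_eq_right) simp
    also have "S * Im (d * cnj a) * (1 + (norm z)\<^sup>2) = S * (2 * Im (z * cnj (a - d))) \<longleftrightarrow>
      Im (d * cnj a) * (1 + (norm z)\<^sup>2) = 2 * Im (z * cnj (a - d))"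
      unfolding mult.assoc using S by (subst mult_cancel_left) auto
    finally show ?thesis using geodesic_arc_iff[OF assms, of z] on[of z]
      by (auto simp: hyperbolic_plane_def dist_norm norm_minus_commute)
  qed
  hence G: "geodesic_arc a d = sphere c r \<inter> hyperbolic_plane" by blast
  have "a \<in> sphere c r \<inter> sphere 0 1" using on[of a] ac na
    by (simp add: dist_norm norm_minus_commute)
  moreover have "(p - c) \<bullet> p = 0" if "p \<in> sphere c r \<inter> sphere 0 1" for p
  proof -
    have "norm (p - c) = r" "norm p = 1" using that by (auto simp: dist_norm norm_minus_commute)
    hence "Re (p * cnj c) = (norm p)\<^sup>2" using on[of p] by simp
    thus ?thesis unfolding inner_complex_def cmod_power2
      by (simp add: power2_eq_square algebra_simps)
  qed
  ultimately show ?thesis unfolding is_geodesic_def using r G by blast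
qed

lemma geodesic_with_endpoints:
  assumes "is_geodesic G" "ideal_endpoints G = {a, d}"
  shows "ideal_pair a d" "G = geodesic_arc a d"
proof -
  obtain p q where pq: "ideal_pair p q" "G = geodesic_arc p q" using is_geodesic_imp_between assms
    by blast
  hence "{p, q} = {a, d}" using ideal_endpoints_geodesic_arc assms by simp
  hence "p = a \<and> q = d \<or> p = d \<and> q = a" by (auto simp: doubleton_eq_iff)
  thus "ideal_pair a d" "G = geodesic_arc a d" using pq ideal_pair_sym geodesic_arc_sym by auto
qed

lemma geodesic_joining_eq: "ideal_pair a d \<Longrightarrow> geodesic_joining a d = geodesic_arc a d"
  unfolding geodesic_joining_def
  using is_geodesic_geodesic_arc ideal_endpoints_geodesic_arc geodesic_with_endpoints(2)
    by (intro the_equality) auto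

section \<open>Crossing geodesics\<close>

lemma hcoord_boundary:
  assumes "ideal_pair a d" "norm p = 1" "p \<noteq> d"
  shows "hcoord a d p = \<i> * of_real (Im (hcoord a d p))"
proof -
  have "Re (hcoord a d p) = 0" using Re_hcoord[OF assms(1,3)] assms by simp
  thus ?thesis by (simp add: complex_eq_iff)
qed

text \<open>In the coordinate of \<open>(a, d)\<close>, the ideal points \<open>p\<close> and \<open>q\<close> sit at \<open>\<i> P\<close> and \<open>\<i> Q\<close>, and the
  geodesic joining them is the semicircle on these two points. It meets the positive real axis
  only at \<open>t\<close> with \<open>t\<^sup>2 = - P Q\<close>, the product of the two coordinates. In the proof, the coordinate
  of \<open>(p, q)\<close> is a Moebius function of that of \<open>(a, d)\<close> with the known imaginary value at \<open>d\<close>,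
  which fixes its constant factor.\<close>
lemma mem_crossing_geodesic_iff:
  assumes ad: "ideal_pair a d" and pq: "ideal_pair p q" and d: "d \<noteq> p" "d \<noteq> q"
    and z: "z \<in> geodesic_arc a d"
  shows "z \<in> geodesic_arc p q \<longleftrightarrow> (hcoord a d z)\<^sup>2 = hcoord a d p * hcoord a d q"
proof -
  note c = geodesic_arc_coord[OF ad z]
  define t where "t = Re (hcoord a d z)"
  define P where "P = Im (hcoord a d p)"
  define Q where "Q = Im (hcoord a d q)"
  define m where "m = Im (hcoord p q d)"
  have zq: "z \<noteq> q" and zp: "z \<noteq> p" using c(1) pq by (auto simp: ideal_pair_def)
  have nn: "norm d = 1" "norm p = 1" "norm q = 1" using ad pq by (auto simp: ideal_pair_def)
  have ht: "hcoord a d z = of_real t" using c(5) by (simp add: t_def)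
  have hP: "hcoord a d p = \<i> * of_real P" unfolding P_def using hcoord_boundary[OF ad nn(2)] d
    by auto
  have hQ: "hcoord a d q = \<i> * of_real Q" unfolding Q_def using hcoord_boundary[OF ad nn(3)] d
    by auto
  have hm: "hcoord p q d = \<i> * of_real m" unfolding m_def using hcoord_boundary[OF pq nn(1)] d
    by auto
  have m0: "m \<noteq> 0" using hm d coord_factor_nonzero[OF pq] by (auto simp: hcoord_def)
  have t0: "t > 0" using c by (simp add: t_def)
  let ?K = "(1 - d * cnj a) * (d - a)"
  have K: "?K \<noteq> 0" using coord_factor_nonzero[OF ad] ad by (auto simp: ideal_pair_def)
  \<comment> \<open>The quotient of the two differences has its zero and its pole at \<open>p\<close> and \<open>q\<close>, like the
    coordinate of \<open>(p, q)\<close>, and it tends to \<open>1\<close> at \<open>d\<close>.\<close>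
  have e: "(hcoord a d z - hcoord a d p) * (hcoord p q d) = hcoord p q z * (hcoord a d z - hcoord a d q)"
    unfolding hcoord_diff[OF c(3) d(1)[symmetric]] hcoord_diff[OF c(3) d(2)[symmetric]]
    using K d c(3) zq by (simp add: hcoord_def divide_simps) (simp add: algebra_simps)
  have t_ne: "of_real t - \<i> * of_real Q \<noteq> 0" using t0 by (simp add: complex_eq_iff)
  have "hcoord p q z = \<i> * of_real m * (of_real t - \<i> * of_real P) / (of_real t - \<i> * of_real Q)"
    using e t_ne unfolding ht hP hQ hm by (simp add: field_simps)
  also have "\<dots> = \<i> * of_real m * (of_real t - \<i> * of_real P) * (of_real t + \<i> * of_real Q) / of_real (t\<^sup>2 + Q\<^sup>2)"
  proof -
    have "(of_real t - \<i> * of_real Q) * (of_real t + \<i> * of_real Q) = of_real (t\<^sup>2 + Q\<^sup>2)"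
      by (simp add: algebra_simps power2_eq_square)
    moreover have "of_real t + \<i> * of_real Q \<noteq> 0" using t0 by (simp add: complex_eq_iff)
    ultimately show ?thesis using t_ne by (metis mult_divide_mult_cancel_right)
  qed
  finally have "Im (hcoord p q z) = m * (t\<^sup>2 + P * Q) / (t\<^sup>2 + Q\<^sup>2)"
    by (simp only: Im_divide_of_real) (simp add: algebra_simps power2_eq_square)
  moreover have "t\<^sup>2 + Q\<^sup>2 \<noteq> 0" using t0 by (simp add: sum_power2_eq_zero_iff)
  ultimately have "z \<in> geodesic_arc p q \<longleftrightarrow> t\<^sup>2 + P * Q = 0"
    using m0 c(1) t0 by (simp add: geodesic_arc_def)
  also have "\<dots> \<longleftrightarrow> complex_of_real (t\<^sup>2) = complex_of_real (- (P * Q))"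
    unfolding of_real_eq_iff by linarith
  also have "complex_of_real (- (P * Q)) = hcoord a d p * hcoord a d q"
    unfolding hP hQ by (simp add: algebra_simps)
  also have "complex_of_real (t\<^sup>2) = (hcoord a d z)\<^sup>2" unfolding ht by simp
  finally show ?thesis .
qed

lemma crossing_point_unique:
  assumes ad: "ideal_pair a d" and pq: "ideal_pair p q" and d: "d \<noteq> p" "d \<noteq> q"
    and "x \<in> geodesic_arc a d \<inter> geodesic_arc p q" "y \<in> geodesic_arc a d \<inter> geodesic_arc p q"
  shows "x = y"
proof -
  have "(hcoord a d x)\<^sup>2 = (hcoord a d y)\<^sup>2" using mem_crossing_geodesic_iff[OF ad pq d] assms(5,6)
    by auto
  moreover have "Re (hcoord a d x) > 0" "Re (hcoord a d y) > 0"
    using geodesic_arc_coord(4)[OF ad] assms by auto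
  ultimately have "hcoord a d x = hcoord a d y" by (auto simp: power2_eq_iff)
  thus ?thesis using hcoord_inj[OF ad] geodesic_arc_coord(3)[OF ad] assms by auto
qed

text \<open>By the previous lemma, a geodesic that meets the one of \<open>(a, d)\<close> twice must end in \<open>d\<close>, and
  by symmetry in \<open>a\<close>.\<close>
lemma geodesic_through_two_points:
  assumes ad: "ideal_pair a d" and pq: "ideal_pair p q"
    and x: "x \<in> geodesic_arc a d \<inter> geodesic_arc p q"
      and y: "y \<in> geodesic_arc a d \<inter> geodesic_arc p q" and "x \<noteq> y"
  shows "{a, d} = {p, q}"
proof -
  have "d \<in> {p, q}" using crossing_point_unique[OF ad pq _ _ x y] \<open>x \<noteq> y\<close> by auto
  moreover have "a \<in> {p, q}"
    using crossing_point_unique[OF ideal_pair_sym[OF ad] pq _ _ , of x y]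
      x y \<open>x \<noteq> y\<close> geodesic_arc_sym[OF ad] by auto
  ultimately show ?thesis using ad by (auto simp: ideal_pair_def)
qed

section \<open>Order of points and hyperbolic distance\<close>

lemma path_parameter_eq_coord:
  assumes "ideal_pair a d" "z \<in> geodesic_arc a d"
  shows "path_parameter a d z = Re (hcoord a d z) / (1 + Re (hcoord a d z))"
  using geodesic_path_surj[OF assms] path_parameter_path[OF assms(1)]
    geodesic_arc_coord(4)[OF assms]
  by (metis add_nonneg_nonneg divide_le_eq_1_pos divide_nonneg_nonneg less_add_same_cancel2 less_eq_real_def zero_less_one add_strict_increasing)

text \<open>Any parametrization from \<open>a\<close> to \<open>d\<close>, composed with the path parameter, is a continuous
  injective function on the unit interval with values \<open>0\<close> and \<open>1\<close> at the ends; so it is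
  increasing, and so is the coordinate.\<close>
lemma in_orderD:
  assumes "in_order a b c d"
  shows "ideal_pair a d \<and> b \<in> geodesic_arc a d \<and> c \<in> geodesic_arc a d \<and> Re (hcoord a d b) < Re (hcoord a d c)"
proof -
  obtain G \<gamma> s t where g: "parametrizes \<gamma> G" and st: "0 < s" "s < t" "t < 1"
    and ends: "pathstart \<gamma> = a" "\<gamma> s = b" "\<gamma> t = c" "pathfinish \<gamma> = d"
    using assms unfolding in_order_def by blast
  have G: "is_geodesic G" "ideal_endpoints G = {a, d}" and arc: "arc \<gamma>"
    and im: "path_image \<gamma> = closure G"
    using g ends by (auto simp: parametrizes_def)
  note ad = geodesic_with_endpoints(1)[OF G] and Ga = geodesic_with_endpoints(2)[OF G]
  have im': "\<gamma> ` {0..1} = geodesic_path a d ` {0..1}"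
    using im Ga closure_geodesic_arc[OF ad] by (simp add: path_image_def)
  define f where "f = path_parameter a d \<circ> \<gamma>"
  have inj: "inj_on \<gamma> {0..1}" and cont: "continuous_on {0..1} \<gamma>"
    using arc by (auto simp: arc_def path_def)
  have cf: "continuous_on {0..1} f" unfolding f_def
    by (intro continuous_on_compose cont) (simp add: im' path_parameter_continuous[OF ad])
  have "inj_on (path_parameter a d) (geodesic_path a d ` {0..1})"
    by (rule inj_onI) (auto simp: path_parameter_path[OF ad])
  hence jf: "inj_on f {0..1}" unfolding f_def by (intro comp_inj_on inj) (simp add: im')
  have g01: "\<gamma> 0 = a" "\<gamma> 1 = d" using ends by (simp_all add: pathstart_def pathfinish_def)
  have f01: "f 0 = 0" "f 1 = 1"
    using path_parameter_path[OF ad, of 0] path_parameter_path[OF ad, of 1] g01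
    by (simp_all add: f_def geodesic_path_ends[OF ad])
  have "f 0 < f t" using continuous_inj_imp_mono[of 0 t 1 f] st cf jf f01 by auto
  moreover have "f 0 < f s \<and> f s < f t \<or> f t < f s \<and> f s < f 0"
    by (rule continuous_inj_imp_mono)
       (use st in \<open>auto intro: continuous_on_subset[OF cf] inj_on_subset[OF jf]\<close>)
  ultimately have lt: "f s < f t" by auto
  have mem: "\<gamma> u \<in> geodesic_arc a d" if "0 < u" "u < 1" for u
  proof -
    have "\<gamma> u \<in> \<gamma> ` {0..1}" using that by simp
    then obtain w where w: "w \<in> {0..1}" "\<gamma> u = geodesic_path a d w" unfolding im' by blast
    have "\<gamma> u \<noteq> \<gamma> 0" "\<gamma> u \<noteq> \<gamma> 1" using inj_on_eq_iff[OF inj, of u] that by simp_all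
    hence "w \<noteq> 0" "w \<noteq> 1" using w geodesic_path_ends[OF ad] g01 by auto
    thus ?thesis using w geodesic_path_in_geodesic[OF ad, of w] by auto
  qed
  have b: "b \<in> geodesic_arc a d" and c: "c \<in> geodesic_arc a d" using mem[of s] mem[of t] st ends
    by auto
  have "Re (hcoord a d b) / (1 + Re (hcoord a d b)) < Re (hcoord a d c) / (1 + Re (hcoord a d c))"
    using lt path_parameter_eq_coord[OF ad b] path_parameter_eq_coord[OF ad c] ends
      by (simp add: f_def)
  hence "Re (hcoord a d b) < Re (hcoord a d c)"
    using geodesic_arc_coord(4)[OF ad b] geodesic_arc_coord(4)[OF ad c]
      by (simp add: divide_simps algebra_simps)
  thus ?thesis using ad b c by blast
qed

lemma parametrizes_geodesic_path:
  assumes "ideal_pair a d" shows "parametrizes (geodesic_path a d) (geodesic_arc a d)"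
proof -
  have "inj_on (geodesic_path a d) {0..1}"
    using path_parameter_path[OF assms] by (intro inj_on_inverseI[of _ "path_parameter a d"]) auto
  thus ?thesis
  using assms is_geodesic_geodesic_arc closure_geodesic_arc ideal_endpoints_geodesic_arc geodesic_path_ends geodesic_path_continuous
  by (auto simp: parametrizes_def arc_def path_def path_image_def pathstart_def pathfinish_def)
qed

lemma in_orderI:
  assumes ad: "ideal_pair a d" and b: "b \<in> geodesic_arc a d" and c: "c \<in> geodesic_arc a d"
    and lt: "Re (hcoord a d b) < Re (hcoord a d c)"
  shows "in_order a b c d"
  unfolding in_order_def
  using parametrizes_geodesic_path[OF ad] geodesic_path_surj[OF ad b] geodesic_path_surj[OF ad c]
     geodesic_arc_coord(4)[OF ad b] geodesic_arc_coord(4)[OF ad c] geodesic_path_ends[OF ad] lt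
  by (intro exI[of _ "geodesic_arc a d"] exI[of _ "geodesic_path a d"]
    exI[of _ "Re (hcoord a d b) / (1 + Re (hcoord a d b))"]
      exI[of _ "Re (hcoord a d c) / (1 + Re (hcoord a d c))"])
     (auto simp: pathstart_def pathfinish_def divide_simps algebra_simps)

text \<open>The cross ratio is the quotient of the two coordinates. The ideal endpoints are determined
  by \<open>b\<close> and \<open>c\<close> as an unordered pair, and the order is determined because swapping them reverses
  the order of coordinates.\<close>
lemma hdist_in_order:
  assumes io: "in_order a b c d"
  shows "hdist b c = ln (Re (hcoord a d c)) - ln (Re (hcoord a d b))"
proof -
  have o: "ideal_pair a d" "b \<in> geodesic_arc a d" "c \<in> geodesic_arc a d"
    "Re (hcoord a d b) < Re (hcoord a d c)"
    using in_orderD[OF io] by blast+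
  note cb = geodesic_arc_coord[OF o(1,2)] and cc = geodesic_arc_coord[OF o(1,3)]
  have ne: "b \<noteq> c" using o by auto
  have uniq: "a' = a \<and> d' = d" if io': "in_order a' b c d'" for a' d'
  proof -
    note o' = in_orderD[OF io']
    have "{a, d} = {a', d'}" using geodesic_through_two_points[OF o(1), of a' d' b c] o o' ne
      by auto
    moreover have False if "a' = d" "d' = a"
    proof -
      have "Re (hcoord d a x) = (norm (a - d))\<^sup>2 / Re (hcoord a d x)" if "x \<in> geodesic_arc a d"
        for x
        using hcoord_swap[OF o(1)] geodesic_arc_coord[OF o(1) that]
        by (metis Re_complex_of_real of_real_divide)
      hence "(norm (a - d))\<^sup>2 / Re (hcoord a d b) < (norm (a - d))\<^sup>2 / Re (hcoord a d c)"
        using o' that o by auto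
      moreover have "(norm (a - d))\<^sup>2 / Re (hcoord a d c) \<le> (norm (a - d))\<^sup>2 / Re (hcoord a d b)"
        using o(4) cb(4) by (intro divide_left_mono) auto
      ultimately show False by simp
    qed
    ultimately show ?thesis by (auto simp: doubleton_eq_iff)
  qed
  have "((a - c) * (b - d)) / ((a - b) * (c - d)) = hcoord a d c / hcoord a d b"
    using coord_factor_nonzero[OF o(1)] cb(2,3) cc(2,3)
      by (simp add: hcoord_def divide_simps) (simp add: algebra_simps)
  also have "\<dots> = of_real (Re (hcoord a d c) / Re (hcoord a d b))" using cb(5) cc(5)
    by (metis of_real_divide)
  finally have "ln (Re (((a - c) * (b - d)) / ((a - b) * (c - d)))) = ln (Re (hcoord a d c)) - ln (Re (hcoord a d b))"
    using cb(4) cc(4) by (simp add: ln_div)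
  hence "(THE l. \<exists>a d. in_order a b c d \<and> l = ln (Re (((a - c) * (b - d)) / ((a - b) * (c - d)))))
     = ln (Re (hcoord a d c)) - ln (Re (hcoord a d b))"
    using io uniq by (intro the_equality) (metis, metis)
  thus ?thesis using ne by (simp add: hdist_def)
qed

text \<open>Along a geodesic the logarithm of the coordinate is arc length.\<close>
lemma hdist_eq_ln_coord_diff:
  assumes ad: "ideal_pair a d" and b: "b \<in> geodesic_arc a d" and c: "c \<in> geodesic_arc a d"
  shows "hdist b c = \<bar>ln (Re (hcoord a d b)) - ln (Re (hcoord a d c))\<bar>"
proof -
  let ?b = "Re (hcoord a d b)" and ?c = "Re (hcoord a d c)"
  note cb = geodesic_arc_coord[OF ad b] and cc = geodesic_arc_coord[OF ad c]
  consider "?b < ?c" | "?c < ?b" | "?b = ?c" by linarith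
  thus ?thesis
  proof cases
    case 1
    thus ?thesis using hdist_in_order[OF in_orderI[OF ad b c 1]] cb(4) by simp
  next
    case 2
    have sw: "Re (hcoord d a x) = (norm (a - d))\<^sup>2 / Re (hcoord a d x)" if "x \<in> geodesic_arc a d"
      for x
      using hcoord_swap[OF ad] geodesic_arc_coord[OF ad that]
        by (metis Re_complex_of_real of_real_divide)
    have n: "(norm (a - d))\<^sup>2 > 0" using ad by (simp add: ideal_pair_def)
    have "Re (hcoord d a b) < Re (hcoord d a c)"
      unfolding sw[OF b] sw[OF c] using n 2 cb(4) cc(4) by (intro divide_strict_left_mono) auto
    hence "in_order d b c a"
      using b c geodesic_arc_sym[OF ad] by (intro in_orderI ideal_pair_sym[OF ad]) auto
    from hdist_in_order[OF this] show ?thesis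
      unfolding sw[OF b] sw[OF c] using n cb(4) cc(4) 2 by (simp add: ln_div)
  next
    case 3
    hence "hcoord a d b = hcoord a d c" using cb(5) cc(5) by metis
    hence "b = c" using hcoord_inj[OF ad cb(3) cc(3)] by blast
    thus ?thesis by (simp add: hdist_def)
  qed
qed

text \<open>The imaginary parts have opposite signs iff \<open>p\<close> and \<open>q\<close> lie on different sides of the
  geodesic from \<open>a\<close> to \<open>d\<close>.\<close>
lemma separated_geodesics_cross:
  assumes ad: "ideal_pair a d" and pq: "ideal_pair p q" and d: "d \<noteq> p" "d \<noteq> q"
    and neg: "Im (hcoord a d p) * Im (hcoord a d q) < 0"
  shows "\<exists>!z. z \<in> geodesic_arc a d \<inter> geodesic_arc p q"
proof -
  define t where "t = sqrt (- (Im (hcoord a d p) * Im (hcoord a d q)))"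
  have t: "t > 0" "t\<^sup>2 = - (Im (hcoord a d p) * Im (hcoord a d q))" using neg by (auto simp: t_def)
  obtain z where z: "z \<in> geodesic_arc a d" "hcoord a d z = of_real t"
    using coord_attained[OF ad t(1)] by blast
  have nn: "norm p = 1" "norm q = 1" using pq by (auto simp: ideal_pair_def)
  define P where "P = Im (hcoord a d p)"
  define Q where "Q = Im (hcoord a d q)"
  have PQ: "hcoord a d p = \<i> * of_real P" "hcoord a d q = \<i> * of_real Q"
    unfolding P_def Q_def using hcoord_boundary[OF ad nn(1)] hcoord_boundary[OF ad nn(2)] d by auto
  have "hcoord a d p * hcoord a d q = of_real (- (P * Q))" unfolding PQ by (simp add: algebra_simps)
  also have "\<dots> = (hcoord a d z)\<^sup>2" using z(2) t(2) unfolding P_def Q_def by (metis of_real_power)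
  finally have "z \<in> geodesic_arc p q" using mem_crossing_geodesic_iff[OF ad pq d z(1)] by simp
  thus ?thesis using z crossing_point_unique[OF ad pq d] by blast
qed

text \<open>The square of the coordinate at a crossing is a product of two boundary coordinates, whose
  absolute values are quotients of chord lengths; the factors \<open>norm (a - d)\<close> cancel between the
  two crossings. This expresses the sides of the triangle by the vertices of the hexagon.\<close>
lemma hdist_crossings:
  assumes ad: "ideal_pair a d" and pq: "ideal_pair p q" and pq': "ideal_pair p' q'"
    and ne: "{p, q, p', q'} \<inter> {a, d} = {}"
    and x: "x \<in> geodesic_arc a d \<inter> geodesic_arc p q"
      and y: "y \<in> geodesic_arc a d \<inter> geodesic_arc p' q'"
  shows "2 * hdist x y =
    \<bar>ln (norm (p - a) * norm (q - a) * norm (p' - d) * norm (q' - d)) -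
     ln (norm (p - d) * norm (q - d) * norm (p' - a) * norm (q' - a))\<bar>"
proof -
  have *: "2 * ln (Re (hcoord a d z)) =  ln (norm (a - d)^2 * ((norm (p - a) * norm (q - a)) / (norm (p - d) * norm (q - d))))"
    if z: "z \<in> geodesic_arc a d" "z \<in> geodesic_arc p q" and pq: "ideal_pair p q"
      and d: "d \<noteq> p" "d \<noteq> q" for z p q
  proof -
    note c = geodesic_arc_coord[OF ad z(1)]
    have "Re (hcoord a d z) = norm (hcoord a d z)" using c(4,5) by (metis abs_of_pos norm_of_real)
    hence "(Re (hcoord a d z))\<^sup>2 = norm (hcoord a d p * hcoord a d q)"
      using mem_crossing_geodesic_iff[OF ad pq d z(1)] z(2) by (metis norm_power)
    also have "\<dots> = norm (a - d)^2 * ((norm (p - a) * norm (q - a)) / (norm (p - d) * norm (q - d)))"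
      by (simp add: hcoord_def norm_mult norm_divide norm_coord_factor[OF ad]
        power2_eq_square norm_minus_commute)
    finally show ?thesis using ln_realpow[of "Re (hcoord a d z)" 2] c(4) by simp
  qed
  have pos: "norm (a - d) > 0" "norm (p - a) > 0" "norm (q - a) > 0" "norm (p - d) > 0"
    "norm (q - d) > 0"
    "norm (p' - a) > 0" "norm (q' - a) > 0" "norm (p' - d) > 0" "norm (q' - d) > 0"
    using ne ad by (auto simp: ideal_pair_def)
  have "hdist x y = \<bar>ln (Re (hcoord a d x)) - ln (Re (hcoord a d y))\<bar>"
    using hdist_eq_ln_coord_diff[OF ad, of x y] x y by blast
  hence "2 * hdist x y = \<bar>2 * ln (Re (hcoord a d x)) - 2 * ln (Re (hcoord a d y))\<bar>" by linarith
  also have "\<dots> = \<bar>ln (norm (p - a) * norm (q - a) * norm (p' - d) * norm (q' - d)) -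
     ln (norm (p - d) * norm (q - d) * norm (p' - a) * norm (q' - a))\<bar>"
    using *[of x p q] *[of y p' q'] x y pq pq' ne pos by (simp add: ln_mult ln_div)
  finally show ?thesis .
qed

section \<open>Horodisks in the half-plane coordinate\<close>

text \<open>The quotient of \<open>(norm (z - p))\<^sup>2\<close> by \<open>1 - (norm z)\<^sup>2\<close> is the exponential of the Busemann
  function at \<open>p\<close>, of which horodisks are the sublevel sets.\<close>
lemma mem_horodisk_iff:
  fixes p z :: complex
  assumes "norm p = 1" "0 < r"
  shows "z \<in> cball (of_real (1 - r) * p) r \<longleftrightarrow> (1 - r) * (norm (z - p))\<^sup>2 \<le> r * (1 - (norm z)\<^sup>2)"
    and "z \<in> ball (of_real (1 - r) * p) r \<longleftrightarrow> (1 - r) * (norm (z - p))\<^sup>2 < r * (1 - (norm z)\<^sup>2)"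
proof -
  have e: "(norm (z - of_real (1 - r) * p))\<^sup>2 - r\<^sup>2
     = (1 - r) * (norm (z - p))\<^sup>2 - r * (1 - (norm z)\<^sup>2)"
  proof -
    have "Re (z * cnj (of_real (1 - r) * p)) = (1 - r) * Re (z * cnj p)"
      by (simp add: algebra_simps)
    moreover have "(norm (of_real (1 - r) * p))\<^sup>2 = (1 - r)\<^sup>2"
      using assms by (simp add: norm_mult power_mult_distrib del: of_real_diff)
    ultimately show ?thesis
      unfolding norm_minus_sq using assms by (simp add: power2_eq_square algebra_simps)
  qed
  have "z \<in> cball (of_real (1 - r) * p) r \<longleftrightarrow> norm (z - of_real (1 - r) * p) \<le> r"
    by (simp add: dist_norm norm_minus_commute)
  also have "\<dots> \<longleftrightarrow> (norm (z - of_real (1 - r) * p))\<^sup>2 \<le> r\<^sup>2" using assms by (simp add: power_mono_iff)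
  finally show "z \<in> cball (of_real (1 - r) * p) r \<longleftrightarrow> (1 - r) * (norm (z - p))\<^sup>2 \<le> r * (1 - (norm z)\<^sup>2)"
    using e by linarith
  have "z \<in> ball (of_real (1 - r) * p) r \<longleftrightarrow> norm (z - of_real (1 - r) * p) < r"
    by (simp add: dist_norm norm_minus_commute)
  also have "\<dots> \<longleftrightarrow> (norm (z - of_real (1 - r) * p))\<^sup>2 < r\<^sup>2" using assms
    by (simp add: power_mono_iff flip: not_le)
  finally show "z \<in> ball (of_real (1 - r) * p) r \<longleftrightarrow> (1 - r) * (norm (z - p))\<^sup>2 < r * (1 - (norm z)\<^sup>2)"
    using e by linarith
qed

lemma horodisk_atI:
  fixes p :: complex
  assumes "norm p = 1" "0 < r" "r < 1"
  shows "horodisk_at p (cball (of_real (1 - r) * p) r)"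
proof -
  have "z = p" if "z \<in> cball (of_real (1 - r) * p) r" "norm z \<ge> 1" for z
  proof -
    have "1 \<le> (norm z)\<^sup>2" using that by simp
    hence "r * (1 - (norm z)\<^sup>2) \<le> 0" using assms by (simp add: mult_nonneg_nonpos)
    hence "(1 - r) * (norm (z - p))\<^sup>2 \<le> 0" using mem_horodisk_iff(1)[OF assms(1,2)] that
      by fastforce
    hence "(norm (z - p))\<^sup>2 \<le> 0" using assms by (simp add: mult_le_0_iff)
    thus ?thesis by simp
  qed
  moreover have "p \<in> cball (of_real (1 - r) * p) r"
    using mem_horodisk_iff(1)[OF assms(1,2), of p] assms by simp
  ultimately have "cball (of_real (1 - r) * p) r - hyperbolic_plane = {p}"
    using assms unfolding hyperbolic_plane_def by (intro equalityI subsetI) (force, simp)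
  thus ?thesis using assms by (auto simp: horodisk_at_def ideal_boundary_def)
qed

text \<open>Since the disk lies in the closed unit disk and contains \<open>p\<close>, equality holds in the triangle
  inequality for \<open>p - c\<close> and \<open>c\<close>; so \<open>c\<close> lies on the radius through \<open>p\<close>.\<close>
lemma horodisk_atD:
  assumes "horodisk_at p H"
  shows "\<exists>r. 0 < r \<and> r < 1 \<and> H = cball (of_real (1 - r) * p) r"
proof -
  obtain c r where r: "r > 0" and H: "H = cball c r" and out: "H - hyperbolic_plane = {p}"
    and p: "norm p = 1"
    using assms by (auto simp: horodisk_at_def ideal_boundary_def)
  have "H \<subseteq> cball 0 1"
  proof
    fix z assume "z \<in> H"
    hence "z \<in> hyperbolic_plane \<or> z = p" using out by blast
    thus "z \<in> cball 0 1" using p by (auto simp: hyperbolic_plane_def)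
  qed
  hence "norm c + r \<le> 1" using r unfolding H by (simp add: cball_subset_cball_iff)
  moreover have pc: "norm (p - c) \<le> r" using out unfolding H
    by (auto simp: dist_norm norm_minus_commute)
  ultimately have nc: "norm c = 1 - r" and npc: "norm (p - c) = r"
    using norm_triangle_ineq[of "p - c" c] p by auto
  have "(norm (p - c))\<^sup>2 = 1 - 2 * Re (p * cnj c) + (1 - r)\<^sup>2"
    unfolding norm_minus_sq using p nc by simp
  hence "Re (p * cnj c) = 1 - r" unfolding npc by (simp add: power2_eq_square algebra_simps)
  moreover have "Re (c * cnj (of_real (1 - r) * p)) = (1 - r) * Re (p * cnj c)"
    by (simp add: algebra_simps)
  ultimately have "(norm (c - of_real (1 - r) * p))\<^sup>2 = 0"
    unfolding norm_minus_sq using p nc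
    by (simp add: norm_mult power_mult_distrib del: of_real_diff) (simp add: power2_eq_square)
  hence c: "c = of_real (1 - r) * p" by simp
  \<comment> \<open>For \<open>r = 1\<close> the disk would be the whole closed unit disk, touching the boundary everywhere.\<close>
  have "r \<noteq> 1"
  proof
    assume "r = 1"
    hence "H = cball 0 1" using H c by simp
    hence "- p \<in> H - hyperbolic_plane" using p by (simp add: hyperbolic_plane_def)
    thus False using out p by (auto simp: complex_eq_iff norm_complex_def)
  qed
  moreover have "r \<le> 1" using nc norm_ge_zero[of c] by simp
  ultimately show ?thesis using r H c by (intro exI[of _ r]) auto
qed

text \<open>On a geodesic starting at \<open>a\<close> the Busemann quotient at \<open>a\<close> is half the coordinate, so a
  horodisk there cuts off an initial ray.\<close>
lemma geodesic_mem_horodisk_start_iff: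
  assumes ad: "ideal_pair a d" and z: "z \<in> geodesic_arc a d" and r: "0 < r" "r < 1"
  shows "z \<in> cball (of_real (1 - r) * a) r \<longleftrightarrow> Re (hcoord a d z) \<le> 2 * r / (1 - r)"
    and "z \<in> ball (of_real (1 - r) * a) r \<longleftrightarrow> Re (hcoord a d z) < 2 * r / (1 - r)"
proof -
  note c = geodesic_arc_coord[OF ad z]
  let ?t = "Re (hcoord a d z)"
  have na: "norm a = 1" and ne: "norm (a - d) \<noteq> 0" using ad by (auto simp: ideal_pair_def)
  have "?t = norm (hcoord a d z)" using c(4,5) by (metis abs_of_pos norm_of_real)
  also have "\<dots> = norm (a - d) * norm (z - a) / norm (d - z)"
    by (simp add: hcoord_def norm_mult norm_divide norm_coord_factor[OF ad])
  finally have "?t * norm (d - z) = norm (a - d) * norm (z - a)" using c(3)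
    by (simp add: field_simps)
  hence "2 * (norm (a - d))\<^sup>2 * (norm (z - a))\<^sup>2 = 2 * (?t * norm (d - z))\<^sup>2"
    by (simp add: power_mult_distrib)
  also have "\<dots> = ?t * (2 * ?t * (norm (d - z))\<^sup>2)" by (simp add: power2_eq_square)
  also have "\<dots> = ?t * ((1 - (norm z)\<^sup>2) * (norm (a - d))\<^sup>2)" unfolding Re_hcoord[OF ad c(3)] ..
  finally have "(norm (a - d))\<^sup>2 * (2 * (norm (z - a))\<^sup>2) = (norm (a - d))\<^sup>2 * (?t * (1 - (norm z)\<^sup>2))"
    by (simp only: mult_ac)
  hence za: "(norm (z - a))\<^sup>2 = ?t * (1 - (norm z)\<^sup>2) / 2" using ne by simp
  have pos: "1 - (norm z)\<^sup>2 > 0" using c(1) by (simp add: power_less_one_iff)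
  have e: "(1 - r) * (norm (z - a))\<^sup>2 - r * (1 - (norm z)\<^sup>2)
     = (1 - (norm z)\<^sup>2) / 2 * (1 - r) * (?t - 2 * r / (1 - r))"
    unfolding za using r by (simp add: field_simps)
  have pos': "(1 - (norm z)\<^sup>2) / 2 * (1 - r) > 0" using pos r by simp
  show "z \<in> cball (of_real (1 - r) * a) r \<longleftrightarrow> ?t \<le> 2 * r / (1 - r)"
    unfolding mem_horodisk_iff(1)[OF na r(1)]
    using e mult_le_0_iff[of "(1 - (norm z)\<^sup>2) / 2 * (1 - r)" "?t - 2 * r / (1 - r)"] pos' by auto
  show "z \<in> ball (of_real (1 - r) * a) r \<longleftrightarrow> ?t < 2 * r / (1 - r)"
    unfolding mem_horodisk_iff(2)[OF na r(1)]
    using e mult_less_0_iff[of "(1 - (norm z)\<^sup>2) / 2 * (1 - r)" "?t - 2 * r / (1 - r)"] pos' by auto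
qed

lemma geodesic_mem_horodisk_end_iff:
  assumes ad: "ideal_pair a d" and z: "z \<in> geodesic_arc a d" and r: "0 < r" "r < 1"
  shows "z \<in> cball (of_real (1 - r) * d) r \<longleftrightarrow> (norm (a - d))\<^sup>2 * (1 - r) / (2 * r) \<le> Re (hcoord a d z)"
    and "z \<in> ball (of_real (1 - r) * d) r \<longleftrightarrow> (norm (a - d))\<^sup>2 * (1 - r) / (2 * r) < Re (hcoord a d z)"
proof -
  note c = geodesic_arc_coord[OF ad z]
  have sw: "Re (hcoord d a z) = (norm (a - d))\<^sup>2 / Re (hcoord a d z)"
    using hcoord_swap[OF ad c(2,3)] c(5) by (metis Re_complex_of_real of_real_divide)
  have z': "z \<in> geodesic_arc d a" using z geodesic_arc_sym[OF ad] by simp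
  show "z \<in> cball (of_real (1 - r) * d) r \<longleftrightarrow> (norm (a - d))\<^sup>2 * (1 - r) / (2 * r) \<le> Re (hcoord a d z)"
    unfolding geodesic_mem_horodisk_start_iff(1)[OF ideal_pair_sym[OF ad] z' r] sw
    using c(4) r by (simp add: field_simps)
  show "z \<in> ball (of_real (1 - r) * d) r \<longleftrightarrow> (norm (a - d))\<^sup>2 * (1 - r) / (2 * r) < Re (hcoord a d z)"
    unfolding geodesic_mem_horodisk_start_iff(2)[OF ideal_pair_sym[OF ad] z' r] sw
    using c(4) r by (simp add: field_simps)
qed

section \<open>Truncated sides and the alternating perimeter\<close>

text \<open>Recovers the endpoints of an open segment from its point set, so that its length does not
  depend on the parametrization.\<close>
lemma segment_endpoints:
  fixes \<gamma> :: "real \<Rightarrow> complex"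
  assumes "arc \<gamma>" "0 < s" "s < t" "t < 1"
  shows "closure (\<gamma> ` {s<..<t}) - \<gamma> ` {s<..<t} = {\<gamma> s, \<gamma> t}"
proof -
  have inj: "inj_on \<gamma> {s..t}" and cont: "continuous_on {s..t} \<gamma>"
    using assms by (auto simp: arc_def path_def intro: inj_on_subset continuous_on_subset)
  have "\<gamma> ` {s..t} - \<gamma> ` {s<..<t} = \<gamma> ` ({s..t} - {s<..<t})"
    using inj by (intro inj_on_image_set_diff[symmetric]) auto
  also have "{s..t} - {s<..<t} = {s, t}" using assms by auto
  finally show ?thesis unfolding closure_open_path[OF cont assms(3)] by simp
qed

lemma hdist_parametrized_sym:
  assumes "parametrizes \<gamma> G" "0 < s" "s < t" "t < 1"
  shows "hdist (\<gamma> t) (\<gamma> s) = hdist (\<gamma> s) (\<gamma> t)"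
proof -
  have "in_order (pathstart \<gamma>) (\<gamma> s) (\<gamma> t) (pathfinish \<gamma>)" using assms unfolding in_order_def
    by blast
  from in_orderD[OF this] show ?thesis using hdist_eq_ln_coord_diff by (metis abs_minus_commute)
qed

lemma segment_length_eq:
  assumes p: "parametrizes \<gamma> G" and st: "0 < s" "s \<le> t" "t < 1"
  shows "segment_length (\<gamma> ` {s<..<t}) = hdist (\<gamma> s) (\<gamma> t)"
  unfolding segment_length_def
proof (rule the_equality)
  show "\<exists>G' \<gamma>' s' t'. parametrizes \<gamma>' G' \<and> 0 < s' \<and> s' \<le> t' \<and> t' < 1 \<and>
     \<gamma> ` {s<..<t} = \<gamma>' ` {s'<..<t'} \<and> hdist (\<gamma> s) (\<gamma> t) = hdist (\<gamma>' s') (\<gamma>' t')"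
    using assms by blast
next
  fix l assume "\<exists>G' \<gamma>' s' t'. parametrizes \<gamma>' G' \<and> 0 < s' \<and> s' \<le> t' \<and> t' < 1 \<and>
     \<gamma> ` {s<..<t} = \<gamma>' ` {s'<..<t'} \<and> l = hdist (\<gamma>' s') (\<gamma>' t')"
  then obtain G' \<gamma>' s' t' where p': "parametrizes \<gamma>' G'" and st': "0 < s'" "s' \<le> t'" "t' < 1"
    and X: "\<gamma> ` {s<..<t} = \<gamma>' ` {s'<..<t'}" and l: "l = hdist (\<gamma>' s') (\<gamma>' t')" by blast
  show "l = hdist (\<gamma> s) (\<gamma> t)"
  proof (cases "s = t")
    case True
    hence "{s'<..<t'} = {}" using X by auto
    hence "s' = t'" using st' by (simp add: greaterThanLessThan_empty_iff)
    thus ?thesis using l True by (simp add: hdist_def)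
  next
    case False
    hence lt: "s < t" using st by simp
    hence "{s'<..<t'} \<noteq> {}" using X by (metis greaterThanLessThan_empty_iff image_is_empty not_le)
    hence lt': "s' < t'" by auto
    have "{\<gamma> s, \<gamma> t} = {\<gamma>' s', \<gamma>' t'}"
      using segment_endpoints[of \<gamma> s t] segment_endpoints[of \<gamma>' s' t'] X lt lt' st st' p p'
      by (simp add: parametrizes_def)
    thus ?thesis using hdist_parametrized_sym[OF p st(1) lt st(3)] l
      by (auto simp: doubleton_eq_iff)
  qed
qed

lemma frac_less_iff: "0 < x \<Longrightarrow> 0 < y \<Longrightarrow> x / (1 + x) < y / (1 + y) \<longleftrightarrow> x < (y::real)"
  by (simp add: field_simps)

lemma geodesic_path_segment:
  assumes ad: "ideal_pair a d" and t: "0 < t0" "0 < t1"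
  shows "{z \<in> geodesic_arc a d. t0 < Re (hcoord a d z) \<and> Re (hcoord a d z) < t1}
     = geodesic_path a d ` {t0 / (1 + t0)<..<t1 / (1 + t1)}" (is "?L = ?R")
proof (intro equalityI subsetI)
  fix z assume z: "z \<in> ?L"
  hence "z \<in> geodesic_arc a d" by simp
  note c = geodesic_arc_coord[OF ad this] and s = geodesic_path_surj[OF ad this]
  show "z \<in> ?R"
    by (rule image_eqI, rule s) (use z c(4) t in \<open>auto simp: frac_less_iff\<close>)
next
  fix z assume "z \<in> ?R"
  then obtain s where s: "z = geodesic_path a d s" "t0 / (1 + t0) < s" "s < t1 / (1 + t1)" by auto
  have "0 < t0 / (1 + t0)" "t1 / (1 + t1) < 1" using t by auto
  hence s01: "0 < s" "s < 1" using s by linarith+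
  have "Re (hcoord a d z) = s / (1 - s)" using hcoord_path(1)[OF ad, of s] s01 s(1) by simp
  moreover have "t0 < s / (1 - s)" "s / (1 - s) < t1" using s(2,3) s01 t
    by (simp_all add: field_simps)
  ultimately show "z \<in> ?L" using geodesic_path_in_geodesic[OF ad s01] s(1) by simp
qed

text \<open>The length splits into a term of the two ideal points and one term for each horodisk.
  Disjointness of the interiors guarantees that the horodisks cut the geodesic in the order \<open>t0 \<le>
  t1\<close>: otherwise the point at the mean of \<open>t0\<close> and \<open>t1\<close> would lie in both.\<close>
lemma truncated_geodesic_length:
  assumes ad: "ideal_pair a d" and r: "0 < r" "r < 1" and r': "0 < r'" "r' < 1"
    and dis: "interior (cball (of_real (1 - r) * a) r) \<inter> interior (cball (of_real (1 - r') * d) r') = {}"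
  shows "segment_length (geodesic_arc a d - (cball (of_real (1 - r) * a) r \<union> cball (of_real (1 - r') * d) r'))
     = 2 * ln (norm (a - d)) + ln ((1 - r) / (2 * r)) + ln ((1 - r') / (2 * r'))"
proof -
  \<comment> \<open>The coordinates at which the two horodisks cut the geodesic.\<close>
  define t0 where "t0 = 2 * r / (1 - r)"
  define t1 where "t1 = (norm (a - d))\<^sup>2 * (1 - r') / (2 * r')"
  have n: "norm (a - d) > 0" using ad by (simp add: ideal_pair_def)
  have t: "t0 > 0" "t1 > 0" using r r' n by (auto simp: t0_def t1_def)
  have "t0 \<le> t1"
  proof (rule ccontr)
    assume "\<not> t0 \<le> t1"
    obtain z where z: "z \<in> geodesic_arc a d" "hcoord a d z = of_real ((t0 + t1) / 2)"
      using coord_attained[OF ad, of "(t0 + t1) / 2"] t by auto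
    hence "Re (hcoord a d z) = (t0 + t1) / 2" by (simp only: Re_complex_of_real)
    hence "z \<in> ball (of_real (1 - r) * a) r" "z \<in> ball (of_real (1 - r') * d) r'"
      unfolding geodesic_mem_horodisk_start_iff(2)[OF ad z(1) r]
        geodesic_mem_horodisk_end_iff(2)[OF ad z(1) r']
      using \<open>\<not> t0 \<le> t1\<close> by (simp_all flip: t0_def t1_def)
    thus False using dis by (simp only: interior_cball) blast
  qed
  have "geodesic_arc a d - (cball (of_real (1 - r) * a) r \<union> cball (of_real (1 - r') * d) r')
    = {z \<in> geodesic_arc a d. t0 < Re (hcoord a d z) \<and> Re (hcoord a d z) < t1}"
    using geodesic_mem_horodisk_start_iff(1)[OF ad _ r] geodesic_mem_horodisk_end_iff(1)[OF ad _ r']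
    unfolding t0_def t1_def by (auto simp only: not_le Diff_iff Un_iff mem_Collect_eq)
  also have "\<dots> = geodesic_path a d ` {t0 / (1 + t0)<..<t1 / (1 + t1)}"
    by (rule geodesic_path_segment[OF ad t])
  also have "segment_length \<dots> = hdist (geodesic_path a d (t0 / (1 + t0))) (geodesic_path a d (t1 / (1 + t1)))"
    by (rule segment_length_eq[OF parametrizes_geodesic_path[OF ad]])
       (use t \<open>t0 \<le> t1\<close> in \<open>auto simp: divide_simps algebra_simps\<close>)
  also have "\<dots> = \<bar>ln t0 - ln t1\<bar>"
  proof -
    have "geodesic_path a d (u / (1 + u)) \<in> geodesic_arc a d \<and> Re (hcoord a d (geodesic_path a d (u / (1 + u)))) = u" if "u > 0" for u
    proof -
      have "u / (1 + u) / (1 - u / (1 + u)) = u" using that by (simp add: field_simps)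
      thus ?thesis
        using geodesic_path_in_geodesic[OF ad, of "u / (1 + u)"]
          hcoord_path(1)[OF ad, of "u / (1 + u)"] that
        by simp
    qed
    thus ?thesis using hdist_eq_ln_coord_diff[OF ad] t by presburger
  qed
  also have "\<dots> = ln t1 - ln t0" using \<open>t0 \<le> t1\<close> t by simp
  also have "\<dots> = 2 * ln (norm (a - d)) + ln ((1 - r) / (2 * r)) + ln ((1 - r') / (2 * r'))"
    using n r r' ln_realpow[of "norm (a - d)" 2] by (simp add: t0_def t1_def ln_mult ln_div)
  finally show ?thesis .
qed

text \<open>A horodisk of radius \<open>r\<close> lies within distance \<open>2 * r\<close> of its ideal point, so a common radius
  of at most a quarter of the shortest side chord avoids overlaps.\<close>
lemma admissible_horodisks_exist:
  assumes v: "\<forall>k \<in> {1..6}. ideal_pair (v k) (v (succ6 k))"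
  shows "\<exists>H. admissible_horodisks v H"
proof -
  define m where "m = Min ((\<lambda>k. norm (v k - v (succ6 k))) ` {1..6})"
  have m: "m > 0" unfolding m_def using v by (subst Min_gr_iff) (auto simp: ideal_pair_def)
  have mle: "m \<le> norm (v k - v (succ6 k))" if "k \<in> {1..6}" for k
    unfolding m_def using that by (intro Min_le) auto
  define r where "r = min (1/2) (m / 4)"
  have r: "0 < r" "r < 1" "4 * r \<le> m" using m by (auto simp: r_def)
  have near: "norm (z - p) < 2 * r" if "norm p = 1" "z \<in> ball (of_real (1 - r) * p) r"
    for z p :: complex
  proof -
    have "z - p = (z - of_real (1 - r) * p) - of_real r * p" by (simp add: algebra_simps)
    hence "norm (z - p) \<le> norm (z - of_real (1 - r) * p) + norm (of_real r * p)"
      by (metis norm_triangle_ineq4)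
    also have "norm (of_real r * p) = r" using that r by (simp add: norm_mult)
    also have "norm (z - of_real (1 - r) * p) < r" using that(2)
      by (simp add: dist_norm norm_minus_commute)
    finally show ?thesis by simp
  qed
  have "admissible_horodisks v (\<lambda>k. cball (of_real (1 - r) * v k) r)"
    unfolding admissible_horodisks_def interior_cball
  proof (intro ballI conjI)
    fix k :: nat assume k: "k \<in> {1..6}"
    have n: "norm (v k) = 1" "norm (v (succ6 k)) = 1" using v k by (auto simp: ideal_pair_def)
    show "horodisk_at (v k) (cball (of_real (1 - r) * v k) r)"
      by (rule horodisk_atI) (use n r in auto)
    show "ball (of_real (1 - r) * v k) r \<inter> ball (of_real (1 - r) * v (succ6 k)) r = {}"
    proof (rule ccontr)
      assume "ball (of_real (1 - r) * v k) r \<inter> ball (of_real (1 - r) * v (succ6 k)) r \<noteq> {}"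
      then obtain z where z: "z \<in> ball (of_real (1 - r) * v k) r"
        "z \<in> ball (of_real (1 - r) * v (succ6 k)) r"
        by blast
      have "norm (v k - v (succ6 k)) \<le> norm (z - v (succ6 k)) + norm (z - v k)"
        using norm_triangle_ineq4[of "z - v (succ6 k)" "z - v k"] by simp
      thus False using near[OF n(1) z(1)] near[OF n(2) z(2)] mle[OF k] r by linarith
    qed
  qed
  thus ?thesis by blast
qed

lemma succ6_simps [simp]: "succ6 1 = 2" "succ6 (Suc 0) = 2" "succ6 2 = 3" "succ6 3 = 4"
  "succ6 4 = 5" "succ6 5 = 6" "succ6 6 = 1"
  by (simp_all add: succ6_def)

text \<open>Each horodisk contributes the same term to the two sides at its vertex, and these enter with
  opposite signs. Hence only the chord lengths survive.\<close>
lemma alternating_perimeter_eq: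
  assumes v: "\<forall>k \<in> {1..6}. ideal_pair (v k) (v (succ6 k))"
  defines "L \<equiv> (\<lambda>k. ln (norm (v k - v (succ6 k))))"
  shows "alternating_perimeter v = 2 * ((L 1 + L 3 + L 5) - (L 2 + L 4 + L 6))"
proof -
  have *: "(truncated_length v H 1 + truncated_length v H 3 + truncated_length v H 5)
       - (truncated_length v H 2 + truncated_length v H 4 + truncated_length v H 6)
       = 2 * ((L 1 + L 3 + L 5) - (L 2 + L 4 + L 6))" if adm: "admissible_horodisks v H" for H
  proof -
    have "\<forall>k\<in>{1..6}. \<exists>r. 0 < r \<and> r < 1 \<and> H k = cball (of_real (1 - r) * v k) r"
      using adm horodisk_atD by (auto simp: admissible_horodisks_def)
    then obtain r where r: "\<And>k. k \<in> {1..6} \<Longrightarrow> 0 < r k" "\<And>k. k \<in> {1..6} \<Longrightarrow> r k < 1"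
      "\<And>k. k \<in> {1..6} \<Longrightarrow> H k = cball (of_real (1 - r k) * v k) (r k)" by metis
    define h where "h = (\<lambda>k. ln ((1 - r k) / (2 * r k)))"
    have "truncated_length v H k = 2 * L k + h k + h (succ6 k)" if k: "k \<in> {1..6}" for k
    proof -
      have k': "succ6 k \<in> {1..6}" using k by (auto simp: succ6_def)
      have ip: "ideal_pair (v k) (v (succ6 k))" using v k by blast
      have "interior (H k) \<inter> interior (H (succ6 k)) = {}" using adm k
        by (auto simp: admissible_horodisks_def)
      thus ?thesis
        unfolding truncated_length_def side_def geodesic_joining_eq[OF ip] r(3)[OF k] r(3)[OF k']
          L_def h_def
        using r(1,2)[OF k] r(1,2)[OF k'] ip by (intro truncated_geodesic_length) auto
    qed
    from this[of 1] this[of 2] this[of 3] this[of 4] this[of 5] this[of 6]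
    show ?thesis by simp
  qed
  obtain H where "admissible_horodisks v H" using admissible_horodisks_exist[OF v] by blast
  thus ?thesis unfolding alternating_perimeter_def using * by (intro the_equality) (metis, metis)
qed

section \<open>Chord lengths of a hexagon as two-by-two minors\<close>

lemma cis_diff: "cis y - cis x = 2 * \<i> * of_real (sin ((y - x) / 2)) * cis ((x + y) / 2)"
proof -
  have "cis y = cis ((x + y) / 2) * cis ((y - x) / 2)"
    "cis x = cis ((x + y) / 2) * cis (- ((y - x) / 2))"
    unfolding cis_mult by (simp_all add: field_simps)
  moreover have "cis u - cis (- u) = 2 * \<i> * of_real (sin u)" for u by (simp add: complex_eq_iff)
  ultimately show ?thesis by (metis (no_types, lifting) mult.commute right_diff_distrib)
qed

lemma norm_cis_diff: "norm (cis y - cis x) = 2 * \<bar>sin ((y - x) / 2)\<bar>"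
  unfolding cis_diff by (simp add: norm_mult)

text \<open>The sign of this expression tells on which side of the geodesic the third point lies.\<close>
lemma hcoord_cis:
  assumes "sin ((z - y) / 2) \<noteq> 0"
  shows "Im (hcoord (cis x) (cis y) (cis z))
     = 2 * sin ((y - x) / 2) * sin ((z - x) / 2) / sin ((z - y) / 2)"
proof -
  have "1 - cis y * cnj (cis x) = cis 0 - cis (y - x)" by (simp add: cis_cnj cis_mult)
  also have "\<dots> = - 2 * \<i> * of_real (sin ((y - x) / 2)) * cis ((y - x) / 2)"
    using sin_minus[of "(y - x) / 2"] unfolding cis_diff by (simp add: mult_ac minus_divide_left)
  finally have k: "1 - cis y * cnj (cis x) = - 2 * \<i> * of_real (sin ((y - x) / 2)) * cis ((y - x) / 2)" .
  have c: "cis ((y - x) / 2) * cis ((x + z) / 2) = cis ((y + z) / 2)"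
    unfolding cis_mult by (simp flip: add_divide_distrib)
  have d: "cis y - cis z = - (2 * \<i> * of_real (sin ((z - y) / 2)) * cis ((y + z) / 2))"
    using cis_diff[of z y] by (metis minus_diff_eq)
  have "hcoord (cis x) (cis y) (cis z) =
     (- 2 * \<i> * of_real (sin ((y - x) / 2)) * (2 * \<i> * of_real (sin ((z - x) / 2))) * (cis ((y - x) / 2) * cis ((x + z) / 2)))
      / (- (2 * \<i> * of_real (sin ((z - y) / 2)) * cis ((y + z) / 2)))"
    unfolding hcoord_def k d cis_diff[of z x] by (simp only: mult_ac)
  also have "\<dots> = \<i> * of_real (2 * sin ((y - x) / 2) * sin ((z - x) / 2) / sin ((z - y) / 2))"
    unfolding c using assms by (simp add: field_simps)
  finally show ?thesis by simp
qed

text \<open>Ideal points correspond to lines in the plane, spanned by \<open>(x k, y k)\<close>, and \<open>b j k\<close> are the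
  minors. Each identity follows from the Pluecker relations. For a convex hexagon the common
  factor vanishes iff the three main diagonals are concurrent; that it is the same in all three
  identities is what aligns the signs of the three sides of the triangle.\<close>
lemma hexagon_bracket_identity:
  fixes x y :: "nat \<Rightarrow> real"
  assumes b: "b = (\<lambda>j k. x j * y k - x k * y j)"
  shows "b 1 2 * b 1 5 * b 3 4 * b 4 6 - b 2 4 * b 4 5 * b 1 3 * b 1 6
       = b 1 4 * (b 1 2 * b 3 4 * b 5 6 - b 2 3 * b 4 5 * b 1 6)"
    and "b 1 2 * b 2 4 * b 3 5 * b 5 6 - b 1 5 * b 4 5 * b 2 3 * b 2 6
       = b 2 5 * (b 1 2 * b 3 4 * b 5 6 - b 2 3 * b 4 5 * b 1 6)"
    and "b 3 4 * b 1 3 * b 5 6 * b 2 6 - b 4 6 * b 1 6 * b 3 5 * b 2 3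
       = b 3 6 * (b 1 2 * b 3 4 * b 5 6 - b 2 3 * b 4 5 * b 1 6)"
  unfolding b by algebra+

text \<open>As vectors one can take \<open>sqrt 2 * (cos (\<theta> / 2), sin (\<theta> / 2))\<close>, so that their minors are the
  chord lengths. The half angles range over less than \<open>pi\<close>, which makes all minors with increasing
  indices positive. The orientation \<open>e\<close> enters the product of the two coordinates only through its
  square.\<close>
lemma hexagon_angles:
  assumes "ideal_hexagon v"
  obtains b :: "nat \<Rightarrow> nat \<Rightarrow> real" and x y :: "nat \<Rightarrow> real"
  where "b = (\<lambda>j k. x j * y k - x k * y j)"
    and "\<And>j k. 1 \<le> j \<Longrightarrow> j < k \<Longrightarrow> k \<le> 6 \<Longrightarrow> b j k > 0 \<and> norm (v j - v k) = b j k"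
    and "\<And>k. 1 \<le> k \<Longrightarrow> k \<le> 6 \<Longrightarrow> norm (v k) = 1"
    and "\<And>i j k l. 1 \<le> i \<Longrightarrow> i < j \<Longrightarrow> j < k \<Longrightarrow> k < l \<Longrightarrow> l \<le> 6 \<Longrightarrow>
           Im (hcoord (v i) (v k) (v j)) * Im (hcoord (v i) (v k) (v l)) < 0"
proof -
  obtain e \<theta> where e: "e \<in> {1, -1::real}" and mono: "strict_mono_on {1..6} \<theta>"
    and range: "\<theta> 6 < \<theta> 1 + 2 * pi" and v: "\<And>k. k \<in> {1..6} \<Longrightarrow> v k = cis (e * \<theta> k)"
    using assms unfolding ideal_hexagon_def by blast
  define x where "x = (\<lambda>k. sqrt 2 * cos (\<theta> k / 2))"
  define y where "y = (\<lambda>k. sqrt 2 * sin (\<theta> k / 2))"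
  define b where "b = (\<lambda>j k. x j * y k - x k * y j)"
  have b: "b j k = 2 * sin ((\<theta> k - \<theta> j) / 2)" for j k
  proof -
    have two: "sqrt 2 * (sqrt 2 * u) = 2 * u" for u by (simp flip: mult.assoc)
    show ?thesis
      unfolding b_def x_def y_def diff_divide_distrib sin_diff by (simp add: algebra_simps two)
  qed
  have odd: "b j k = - b k j" for j k by (simp add: b_def)
  have lt: "\<theta> j < \<theta> k" if "1 \<le> j" "j < k" "k \<le> 6" for j k
    using mono that by (auto simp: strict_mono_on_def)
  have le: "\<theta> j \<le> \<theta> k" if "1 \<le> j" "j \<le> k" "k \<le> 6" for j k
    using lt[of j k] that by (cases "j = k") auto
  have pos: "b j k > 0" if "1 \<le> j" "j < k" "k \<le> 6" for j k
    unfolding b using that lt[of j k] le[of 1 j] le[of k 6] range by (simp add: sin_gt_zero)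
  have esin: "sin ((e * \<theta> k - e * \<theta> j) / 2) = e * b j k / 2" for j k
    using e odd[of j k] by (auto simp: b)
  show thesis
  proof
    show "b = (\<lambda>j k. x j * y k - x k * y j)" by (rule b_def)
    show "b j k > 0 \<and> norm (v j - v k) = b j k" if "1 \<le> j" "j < k" "k \<le> 6" for j k
      using pos[OF that] e that odd[of k j] by (auto simp: v norm_cis_diff esin)
    show "norm (v k) = 1" if "1 \<le> k" "k \<le> 6" for k using that by (simp add: v)
    show "Im (hcoord (v i) (v k) (v j)) * Im (hcoord (v i) (v k) (v l)) < 0"
      if ijkl: "1 \<le> i" "i < j" "j < k" "k < l" "l \<le> 6" for i j k l
    proof -
      have p: "b i j > 0" "b i k > 0" "b i l > 0" "b j k > 0" "b k l > 0" using pos ijkl by auto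
      have e0: "e \<noteq> 0" "e * e = 1" using e by auto
      have "Im (hcoord (v i) (v k) (v j)) = e * b i k * (e * b i j) / (e * b k j)"
        using hcoord_cis[of "e * \<theta> j" "e * \<theta> k" "e * \<theta> i"] ijkl p odd[of k j] e0
          by (simp add: v esin)
      moreover have "Im (hcoord (v i) (v k) (v l)) = e * b i k * (e * b i l) / (e * b k l)"
        using hcoord_cis[of "e * \<theta> l" "e * \<theta> k" "e * \<theta> i"] ijkl p e0 by (simp add: v esin)
      ultimately have "Im (hcoord (v i) (v k) (v j)) * Im (hcoord (v i) (v k) (v l))
         = - ((e * e) * ((b i k)\<^sup>2 * b i j * b i l / (b j k * b k l)))"
        using e0 p by (simp add: odd[of k j] power2_eq_square)
      thus ?thesis using p e0 by simp
    qed
  qed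
qed

lemma abs_sum_same_sign:
  fixes p q r u :: real
  assumes "p + q + r = u" "sgn p = sgn q" "sgn q = sgn r"
  shows "\<bar>p\<bar> + \<bar>q\<bar> + \<bar>r\<bar> = \<bar>u\<bar>"
  using assms by (auto simp: sgn_if split: if_splits)

lemma sgn_ln_diff:
  fixes m n w u :: real
  assumes "0 < n" "0 < m" "0 < w" "n - m = w * u"
  shows "sgn (ln n - ln m) = sgn u"
proof -
  have "sgn (ln n - ln m) = sgn (n - m)" using assms(1,2) by (auto simp: sgn_if)
  thus ?thesis using assms(3,4) by (simp add: sgn_mult)
qed

text \<open>The three differences have equal signs by the bracket identities, so their absolute values
  add up to the absolute value of their sum; in the sum, every chord that is not a side cancels.\<close>
lemma hexagon_log_identity:
  fixes b :: "nat \<Rightarrow> nat \<Rightarrow> real"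
  assumes b: "b = (\<lambda>j k. x j * y k - x k * y j)"
    and pos: "\<And>j k. 1 \<le> j \<Longrightarrow> j < k \<Longrightarrow> k \<le> 6 \<Longrightarrow> b j k > 0"
  shows "\<bar>ln (b 1 2 * b 1 5 * b 3 4 * b 4 6) - ln (b 2 4 * b 4 5 * b 1 3 * b 1 6)\<bar>
       + \<bar>ln (b 1 2 * b 2 4 * b 3 5 * b 5 6) - ln (b 1 5 * b 4 5 * b 2 3 * b 2 6)\<bar>
       + \<bar>ln (b 3 4 * b 1 3 * b 5 6 * b 2 6) - ln (b 4 6 * b 1 6 * b 3 5 * b 2 3)\<bar>
       = 2 * \<bar>ln (b 1 2) + ln (b 3 4) + ln (b 5 6) - (ln (b 2 3) + ln (b 4 5) + ln (b 1 6))\<bar>"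
proof -
  have p: "b 1 2 > 0" "b 1 3 > 0" "b 1 4 > 0" "b 1 5 > 0" "b 1 6 > 0" "b 2 3 > 0" "b 2 4 > 0"
    "b 2 5 > 0"
    "b 2 6 > 0" "b 3 4 > 0" "b 3 5 > 0" "b 3 6 > 0" "b 4 5 > 0" "b 4 6 > 0" "b 5 6 > 0"
    by (rule pos; simp)+
  let ?u = "b 1 2 * b 3 4 * b 5 6 - b 2 3 * b 4 5 * b 1 6"
  have s1: "sgn (ln (b 1 2 * b 1 5 * b 3 4 * b 4 6) - ln (b 2 4 * b 4 5 * b 1 3 * b 1 6)) = sgn ?u"
    by (rule sgn_ln_diff[OF _ _ p(3) hexagon_bracket_identity(1)[OF b]]; intro mult_pos_pos p)
  have s2: "sgn (ln (b 1 2 * b 2 4 * b 3 5 * b 5 6) - ln (b 1 5 * b 4 5 * b 2 3 * b 2 6)) = sgn ?u"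
    by (rule sgn_ln_diff[OF _ _ p(8) hexagon_bracket_identity(2)[OF b]]; intro mult_pos_pos p)
  have s3: "sgn (ln (b 3 4 * b 1 3 * b 5 6 * b 2 6) - ln (b 4 6 * b 1 6 * b 3 5 * b 2 3)) = sgn ?u"
    by (rule sgn_ln_diff[OF _ _ p(12) hexagon_bracket_identity(3)[OF b]]; intro mult_pos_pos p)
  have "\<bar>ln (b 1 2 * b 1 5 * b 3 4 * b 4 6) - ln (b 2 4 * b 4 5 * b 1 3 * b 1 6)\<bar>
       + \<bar>ln (b 1 2 * b 2 4 * b 3 5 * b 5 6) - ln (b 1 5 * b 4 5 * b 2 3 * b 2 6)\<bar>
       + \<bar>ln (b 3 4 * b 1 3 * b 5 6 * b 2 6) - ln (b 4 6 * b 1 6 * b 3 5 * b 2 3)\<bar>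
       = \<bar>2 * (ln (b 1 2) + ln (b 3 4) + ln (b 5 6) - (ln (b 2 3) + ln (b 4 5) + ln (b 1 6)))\<bar>"
  proof (rule abs_sum_same_sign)
    show "ln (b 1 2 * b 1 5 * b 3 4 * b 4 6) - ln (b 2 4 * b 4 5 * b 1 3 * b 1 6)
       + (ln (b 1 2 * b 2 4 * b 3 5 * b 5 6) - ln (b 1 5 * b 4 5 * b 2 3 * b 2 6))
       + (ln (b 3 4 * b 1 3 * b 5 6 * b 2 6) - ln (b 4 6 * b 1 6 * b 3 5 * b 2 3))
       = 2 * (ln (b 1 2) + ln (b 3 4) + ln (b 5 6) - (ln (b 2 3) + ln (b 4 5) + ln (b 1 6)))"
      using p by (simp add: ln_mult)
    show "sgn (ln (b 1 2 * b 1 5 * b 3 4 * b 4 6) - ln (b 2 4 * b 4 5 * b 1 3 * b 1 6))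
      = sgn (ln (b 1 2 * b 2 4 * b 3 5 * b 5 6) - ln (b 1 5 * b 4 5 * b 2 3 * b 2 6))"
      using s1 s2 by simp
    show "sgn (ln (b 1 2 * b 2 4 * b 3 5 * b 5 6) - ln (b 1 5 * b 4 5 * b 2 3 * b 2 6))
      = sgn (ln (b 3 4 * b 1 3 * b 5 6 * b 2 6) - ln (b 4 6 * b 1 6 * b 3 5 * b 2 3))"
      using s2 s3 by simp
  qed
  thus ?thesis unfolding abs_mult by simp
qed

section \<open>The perimeter of the triangle\<close>

lemma triangle_vertex_mem:
  assumes "ideal_pair (v j) (v (j + 3))" "ideal_pair (v k) (v (k + 3))"
    "\<exists>!z. z \<in> geodesic_arc (v j) (v (j + 3)) \<inter> geodesic_arc (v k) (v (k + 3))"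
  shows "triangle_vertex v j k \<in> geodesic_arc (v j) (v (j + 3)) \<inter> geodesic_arc (v k) (v (k + 3))"
  unfolding triangle_vertex_def diagonal_def geodesic_joining_eq[OF assms(1)]
    geodesic_joining_eq[OF assms(2)]
  by (rule theI') (rule assms(3))

theorem theorem3p1:
  fixes v :: "nat \<Rightarrow> complex"
  assumes "ideal_hexagon v"
  shows "\<bar>alternating_perimeter v\<bar> = 2 * triangle_perimeter v"
proof -
  obtain b :: "nat \<Rightarrow> nat \<Rightarrow> real" and x y :: "nat \<Rightarrow> real"
  where b_eq: "b = (\<lambda>j k. x j * y k - x k * y j)"
    and b: "\<And>j k. 1 \<le> j \<Longrightarrow> j < k \<Longrightarrow> k \<le> 6 \<Longrightarrow> b j k > 0 \<and> norm (v j - v k) = b j k"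
    and unit: "\<And>k. 1 \<le> k \<Longrightarrow> k \<le> 6 \<Longrightarrow> norm (v k) = 1"
    and sep: "\<And>i j k l. 1 \<le> i \<Longrightarrow> i < j \<Longrightarrow> j < k \<Longrightarrow> k < l \<Longrightarrow> l \<le> 6 \<Longrightarrow>
           Im (hcoord (v i) (v k) (v j)) * Im (hcoord (v i) (v k) (v l)) < 0"
    using hexagon_angles[OF assms] by blast
  have pos: "b j k > 0" and n: "norm (v j - v k) = b j k" if "1 \<le> j" "j < k" "k \<le> 6" for j k
    using b[OF that] by auto
  have b': "norm (v k - v j) = b j k" if "1 \<le> j" "j < k" "k \<le> 6" for j k
    using b[OF that] by (simp add: norm_minus_commute)
  have ne: "v j \<noteq> v k" if "1 \<le> j" "j < k" "k \<le> 6" for j k using b[OF that] by auto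
  have ip: "ideal_pair (v j) (v k)" if "1 \<le> j" "j < k" "k \<le> 6" for j k
    using ne[OF that] unit that by (auto simp: ideal_pair_def)
  have ne': "v j \<noteq> v k" if "j \<in> {1..6}" "k \<in> {1..6}" "j \<noteq> k" for j k
    using ne[of j k] ne[of k j] that by (cases "j < k") auto
  have sides: "\<forall>k \<in> {1..6}. ideal_pair (v k) (v (succ6 k))"
  proof
    fix k :: nat assume k: "k \<in> {1..6}"
    show "ideal_pair (v k) (v (succ6 k))"
      using ip[of k "k + 1"] ideal_pair_sym[OF ip[of 1 6]] k
        by (cases "k = 6") (auto simp: succ6_def)
  qed
  have cross: "triangle_vertex v j k \<in> geodesic_arc (v j) (v (j + 3)) \<inter> geodesic_arc (v k) (v (k + 3))"
    if "1 \<le> j" "j < k" "k \<le> 3" for j k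
    by (intro triangle_vertex_mem separated_geodesics_cross ip ne' sep) (use that ne' in auto)
  define X where "X = triangle_vertex v 1 2"
  define Y where "Y = triangle_vertex v 2 3"
  define Z where "Z = triangle_vertex v 1 3"
  have X: "X \<in> geodesic_arc (v 1) (v 4)" "X \<in> geodesic_arc (v 2) (v 5)" using cross[of 1 2]
    by (auto simp: X_def)
  have Y: "Y \<in> geodesic_arc (v 2) (v 5)" "Y \<in> geodesic_arc (v 3) (v 6)" using cross[of 2 3]
    by (auto simp: Y_def)
  have Z: "Z \<in> geodesic_arc (v 1) (v 4)" "Z \<in> geodesic_arc (v 3) (v 6)" using cross[of 1 3]
    by (auto simp: Z_def)
  \<comment> \<open>The arguments of the logarithms are arranged as in \<open>hexagon_log_identity\<close>; for the other two
    sides numerator and denominator are exchanged.\<close>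
  have XY: "2 * hdist X Y = \<bar>ln (b 1 2 * b 2 4 * b 3 5 * b 5 6) - ln (b 1 5 * b 4 5 * b 2 3 * b 2 6)\<bar>"
    using hdist_crossings[OF ip[of 2 5] ip[of 1 4] ip[of 3 6] _ IntI IntI, of X Y] X Y
    by (simp add: ne' n b' abs_minus_commute mult_ac)
  have ZX: "2 * hdist Z X = \<bar>ln (b 1 2 * b 1 5 * b 3 4 * b 4 6) - ln (b 2 4 * b 4 5 * b 1 3 * b 1 6)\<bar>"
    using hdist_crossings[OF ip[of 1 4] ip[of 3 6] ip[of 2 5] _ IntI IntI, of Z X] Z X
    by (simp add: ne' n b' abs_minus_commute mult_ac)
  have YZ: "2 * hdist Y Z = \<bar>ln (b 3 4 * b 1 3 * b 5 6 * b 2 6) - ln (b 4 6 * b 1 6 * b 3 5 * b 2 3)\<bar>"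
    using hdist_crossings[OF ip[of 3 6] ip[of 2 5] ip[of 1 4] _ IntI IntI, of Y Z] Y Z
    by (simp add: ne' n b' abs_minus_commute mult_ac)
  have "2 * triangle_perimeter v = 2 * hdist Z X + 2 * hdist X Y + 2 * hdist Y Z"
    unfolding triangle_perimeter_def X_def Y_def Z_def by simp
  also have "\<dots> = 2 * \<bar>ln (b 1 2) + ln (b 3 4) + ln (b 5 6) - (ln (b 2 3) + ln (b 4 5) + ln (b 1 6))\<bar>"
    unfolding XY YZ ZX using b by (intro hexagon_log_identity[OF b_eq]) blast
  also have "\<dots> = \<bar>alternating_perimeter v\<bar>"
  proof -
    have "alternating_perimeter v
      = 2 * (ln (b 1 2) + ln (b 3 4) + ln (b 5 6) - (ln (b 2 3) + ln (b 4 5) + ln (b 1 6)))"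
      unfolding alternating_perimeter_eq[OF sides] succ6_simps by (simp add: n b')
    thus ?thesis by (simp only: abs_mult abs_numeral)
  qed
  finally show ?thesis by simp
qed

end
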